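(* Let $f:2^X\to\mathbb{R}_{\ge0}$ be non-negative submodular, $\varepsilon>0$, and run MultipassRandomizedLocalSearch$(\alpha,\beta_1,\dots,\beta_d,m)$ with $\alpha=\varepsilon f(\mathit{OPT})/(2k)$, buffer size $m=4dk/\varepsilon^2$ and arbitrary $\beta_1,\dots,\beta_d>0$. Let $d\ge i>1$, and suppose that at the start of the $i$-th pass we have $(1-\varepsilon)f(\mathit{OPT})\le\gamma_{i-1}\mathbb{E}[f(S_{i-1})]+\bar\gamma_{\mathrm{off}}\mathbb{E}[f(S'_{i-1})]$ for some real $\gamma_{i-1}$, and that $\mathbb{E}[f(S_i)]>0$. Then, with $\delta_i=\mathbb{E}[f(S_{i-1})]/\mathbb{E}[f(S_i)]$, \[ (1-\varepsilon)f(\mathit{OPT})\le\min\Bigl\{\gamma_{i-1}\delta_i,\ \Bigl(\frac{p}{\beta_i}+p-1\Bigr)(1-\delta_i)+p+\beta_ip+1\Bigr\}\cdot\mathbb{E}[f(S_i)]+\bar\gamma_{\mathrm{off}}\mathbb{E}[f(S'_i)]. \]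
   Context: $X$ is a finite ground set and $f:2^X\to\mathbb{R}_{\ge0}$ is submodular (not necessarily monotone). For $e\in X$, $A\subseteq X$ write $f(e\mid A)=f(A\cup\{e\})-f(A)$. A $p$-matchoid on $X$ is a collection of matroids $\mathcal{M}_\ell=(X_\ell,\mathcal{I}_\ell)$, $X_\ell\subseteq X$, with every element of $X$ in at most $p$ of the sets $X_\ell$; $S$ is feasible ($S\in\mathcal{I}$) iff $S\cap X_\ell\in\mathcal{I}_\ell$ for all $\ell$. The rank $k$ is the maximum size of a feasible set; $\mathit{OPT}$ is a feasible set maximizing $f$. Elements of $X$ arrive one at a time in a stream; each pass receives all of $X$. Offline is an algorithm with approximation factor $\bar\gamma_{\mathrm{off}}$: given $B\subseteq X$ it returns a feasible $S'\subseteq B$ with $\max_{T\subseteq B,T\in\mathcal{I}}f(T)\le\bar\gamma_{\mathrm{off}}\mathbb{E}[f(S')]$. Incremental values: for a total order $\prec$ on $X$, $\nu(e,T)=f(e\mid\{t\in T:t\prec e\})$; here $\prec$ is the order in which elements are inserted into the current solution $S$, elements of the initial solution coming first in their previous order. Exchange$(x,S)$: start with $C_x=\emptyset$; for each $\mathcal{M}_\ell$ with $x\in X_\ell$, let $S_\ell=S\cap X_\ell$; if $S_\ell\cup\{x\}\notin\mathcal{I}_\ell$, let $T_\ell=\{y\in S_\ell:(S_\ell\setminus\{y\})\cup\{x\}\in\mathcal{I}_\ell\}$ and add to $C_x$ an element of $T_\ell$ minimizing $\nu(\cdot,S)$. Return $C_x$. RandomizedLocalSearch$(S_{\mathrm{init}},\alpha,\beta,m)$: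 $S\leftarrow S_{\mathrm{init}}$, $B\leftarrow\emptyset$. For each arriving $x$: with $C_x=$ Exchange$(x,S)$, if $f(x\mid S)\ge\alpha+(1+\beta)\sum_{e\in C_x}\nu(e,S)$ add $x$ to $B$. Whenever $|B|=m$: choose $x$ uniformly at random from $B$, compute $C_x=$ Exchange$(x,S)$, remove $x$ from $B$, set $S\leftarrow(S\setminus C_x)\cup\{x\}$; then for each $x'\in B$ recompute $C_{x'}=$ Exchange$(x',S)$ and remove $x'$ from $B$ if $f(x'\mid S)<\alpha+(1+\beta)\sum_{e\in C_{x'}}\nu(e,S)$. At the end of the stream set $S'=$ Offline$(B)$ and return $(S,S')$. MultipassRandomizedLocalSearch$(\alpha,\beta_1,\dots,\beta_d,m)$: $S_0=S'_0=\emptyset$; for $i=1,\dots,d$, let $(\tilde S,S')$ be the output of RandomizedLocalSearch$(S_{i-1},\alpha,\beta_i,m)$ on a new pass, set $S_i=\tilde S$ and $S'_i$ the one of $S'_{i-1},S'$ with larger $f$-value. Return the one of $S_d,S'_d$ with larger $f$-value. *)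

theory Defs
  imports "HOL-Probability.Probability"
begin

definition matroid :: "'a set \<Rightarrow> 'a set set \<Rightarrow> bool" where
  "matroid E Ind \<longleftrightarrow> finite E \<and> Ind \<subseteq> Pow E \<and> {} \<in> Ind \<and>
     (\<forall>A B. B \<in> Ind \<and> A \<subseteq> B \<longrightarrow> A \<in> Ind) \<and>
     (\<forall>A B. A \<in> Ind \<and> B \<in> Ind \<and> card A < card B \<longrightarrow> (\<exists>e\<in>B - A. insert e A \<in> Ind))"

text \<open>The collection of matroids is the family of pairs \<open>(G l, I l)\<close>, indexed by \<open>l \<in> L\<close>.\<close>

definition matchoid :: "nat \<Rightarrow> 'a set \<Rightarrow> 'l set \<Rightarrow> ('l \<Rightarrow> 'a set) \<Rightarrow> ('l \<Rightarrow> 'a set set) \<Rightarrow> bool" where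
  "matchoid p X L G I \<longleftrightarrow> finite X \<and> finite L \<and>
     (\<forall>l\<in>L. G l \<subseteq> X \<and> matroid (G l) (I l)) \<and>
     (\<forall>x\<in>X. card {l\<in>L. x \<in> G l} \<le> p)"

definition feasible :: "'a set \<Rightarrow> 'l set \<Rightarrow> ('l \<Rightarrow> 'a set) \<Rightarrow> ('l \<Rightarrow> 'a set set) \<Rightarrow> 'a set \<Rightarrow> bool" where
  "feasible X L G I S \<longleftrightarrow> S \<subseteq> X \<and> (\<forall>l\<in>L. S \<inter> G l \<in> I l)"

definition matchoid_rank :: "'a set \<Rightarrow> 'l set \<Rightarrow> ('l \<Rightarrow> 'a set) \<Rightarrow> ('l \<Rightarrow> 'a set set) \<Rightarrow> nat" where
  "matchoid_rank X L G I = Max (card ` {S. feasible X L G I S})"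

definition nonneg_on :: "'a set \<Rightarrow> ('a set \<Rightarrow> real) \<Rightarrow> bool" where
  "nonneg_on X f \<longleftrightarrow> (\<forall>A\<subseteq>X. 0 \<le> f A)"

definition submodular_on :: "'a set \<Rightarrow> ('a set \<Rightarrow> real) \<Rightarrow> bool" where
  "submodular_on X f \<longleftrightarrow> (\<forall>A\<subseteq>X. \<forall>B\<subseteq>X. f (A \<union> B) + f (A \<inter> B) \<le> f A + f B)"

text \<open>A randomized algorithm that returns a subset of its input \<open>B\<close>.\<close>

definition offline_approx ::
  "'a set \<Rightarrow> 'l set \<Rightarrow> ('l \<Rightarrow> 'a set) \<Rightarrow> ('l \<Rightarrow> 'a set set) \<Rightarrow> ('a set \<Rightarrow> real)
    \<Rightarrow> real \<Rightarrow> ('a set \<Rightarrow> 'a set pmf) \<Rightarrow> bool" where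
  "offline_approx X L G I f g offline \<longleftrightarrow> (\<forall>B\<subseteq>X.
     (\<forall>S'\<in>set_pmf (offline B). S' \<subseteq> B \<and> feasible X L G I S') \<and>
     Max (f ` {T. T \<subseteq> B \<and> feasible X L G I T}) \<le> g * measure_pmf.expectation (offline B) f)"

definition marginal :: "('a set \<Rightarrow> real) \<Rightarrow> 'a \<Rightarrow> 'a set \<Rightarrow> real" where
  "marginal f e A = f (A \<union> {e}) - f A"

text \<open>The current solution is kept as a list, in order of insertion.\<close>

definition incr :: "('a set \<Rightarrow> real) \<Rightarrow> 'a \<Rightarrow> 'a list \<Rightarrow> real" where
  "incr f e S = marginal f e (set (takeWhile (\<lambda>t. t \<noteq> e) S))"

definition conflicts :: "('l \<Rightarrow> 'a set) \<Rightarrow> ('l \<Rightarrow> 'a set set) \<Rightarrow> 'a \<Rightarrow> 'a list \<Rightarrow> 'l \<Rightarrow> bool" where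
  "conflicts G I x S l \<longleftrightarrow> x \<in> G l \<and> insert x (set S \<inter> G l) \<notin> I l"

definition swaps :: "('l \<Rightarrow> 'a set) \<Rightarrow> ('l \<Rightarrow> 'a set set) \<Rightarrow> 'a \<Rightarrow> 'a list \<Rightarrow> 'l \<Rightarrow> 'a set" where
  "swaps G I x S l = {y \<in> set S \<inter> G l. insert x ((set S \<inter> G l) - {y}) \<in> I l}"

text \<open>\<open>sel x S l\<close> is the element of \<open>swaps G I x S l\<close> of minimum incremental value that is
  used by the exchange step; ties may be broken in any way.\<close>

definition min_selection ::
  "'l set \<Rightarrow> ('l \<Rightarrow> 'a set) \<Rightarrow> ('l \<Rightarrow> 'a set set) \<Rightarrow> ('a set \<Rightarrow> real) \<Rightarrow> ('a \<Rightarrow> 'a list \<Rightarrow> 'l \<Rightarrow> 'a) \<Rightarrow> bool" where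
  "min_selection L G I f sel \<longleftrightarrow> (\<forall>x S. \<forall>l\<in>L. conflicts G I x S l \<and> swaps G I x S l \<noteq> {} \<longrightarrow>
     is_arg_min (\<lambda>y. incr f y S) (\<lambda>y. y \<in> swaps G I x S l) (sel x S l))"

locale local_search =
  fixes L :: "'l set"
    and G :: "'l \<Rightarrow> 'a set"
    and I :: "'l \<Rightarrow> 'a set set"
    and f :: "'a set \<Rightarrow> real"
    and sel :: "'a \<Rightarrow> 'a list \<Rightarrow> 'l \<Rightarrow> 'a"
    and offline :: "'a set \<Rightarrow> 'a set pmf"
begin

definition exchange :: "'a \<Rightarrow> 'a list \<Rightarrow> 'a set" where
  "exchange x S = {sel x S l | l. l \<in> L \<and> conflicts G I x S l}"

text \<open>When \<open>x\<close> conflicts with \<open>S\<close> in a matroid but \<open>swaps\<close> is empty there (for feasible \<open>S\<close>: when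
  \<open>x\<close> is a loop of that matroid, hence in no feasible set), there is nothing to minimize over.
  The minimum is then read as infinite, so \<open>x\<close> fails the test.\<close>

definition passes :: "real \<Rightarrow> real \<Rightarrow> 'a list \<Rightarrow> 'a \<Rightarrow> bool" where
  "passes \<alpha> \<beta> S x \<longleftrightarrow> (\<forall>l\<in>L. conflicts G I x S l \<longrightarrow> swaps G I x S l \<noteq> {}) \<and>
     marginal f x (set S) \<ge> \<alpha> + (1 + \<beta>) * (\<Sum>e\<in>exchange x S. incr f e S)"

definition insert_sol :: "'a \<Rightarrow> 'a list \<Rightarrow> 'a list" where
  "insert_sol x S = filter (\<lambda>y. y \<notin> exchange x S \<and> y \<noteq> x) S @ [x]"

definition flush :: "real \<Rightarrow> real \<Rightarrow> 'a list \<times> 'a set \<Rightarrow> ('a list \<times> 'a set) pmf" where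
  "flush \<alpha> \<beta> = (\<lambda>(S, B). do {
     x \<leftarrow> pmf_of_set B;
     let T = insert_sol x S;
     return_pmf (T, {y \<in> B - {x}. passes \<alpha> \<beta> T y}) })"

text \<open>A flush shrinks the buffer, so the buffer can only reach size \<open>m > 0\<close> by an insertion, and
  one flush per insertion suffices.\<close>

definition arrive :: "real \<Rightarrow> real \<Rightarrow> nat \<Rightarrow> 'a \<Rightarrow> 'a list \<times> 'a set \<Rightarrow> ('a list \<times> 'a set) pmf" where
  "arrive \<alpha> \<beta> m x = (\<lambda>(S, B).
     if passes \<alpha> \<beta> S x then
       (if card (insert x B) = m then flush \<alpha> \<beta> (S, insert x B) else return_pmf (S, insert x B))
     else return_pmf (S, B))"

primrec process :: "real \<Rightarrow> real \<Rightarrow> nat \<Rightarrow> 'a list \<Rightarrow> 'a list \<times> 'a set \<Rightarrow> ('a list \<times> 'a set) pmf" where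
  "process \<alpha> \<beta> m [] st = return_pmf st"
| "process \<alpha> \<beta> m (x # xs) st = bind_pmf (arrive \<alpha> \<beta> m x st) (process \<alpha> \<beta> m xs)"

definition randomized_local_search ::
  "'a list \<Rightarrow> 'a list \<Rightarrow> real \<Rightarrow> real \<Rightarrow> nat \<Rightarrow> ('a list \<times> 'a set) pmf" where
  "randomized_local_search stream Sinit \<alpha> \<beta> m = do {
     (S, B) \<leftarrow> process \<alpha> \<beta> m stream (Sinit, {});
     S' \<leftarrow> offline B;
     return_pmf (S, S') }"

text \<open>The joint distribution of \<open>(S\<^sub>i, S'\<^sub>i)\<close> after \<open>i\<close> passes. The arrival order \<open>stream i\<close> may
  change from pass to pass.\<close>

primrec multipass ::
  "(nat \<Rightarrow> 'a list) \<Rightarrow> real \<Rightarrow> (nat \<Rightarrow> real) \<Rightarrow> nat \<Rightarrow> nat \<Rightarrow> ('a list \<times> 'a set) pmf" where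
  "multipass stream \<alpha> \<beta> m 0 = return_pmf ([], {})"
| "multipass stream \<alpha> \<beta> m (Suc i) = do {
     (S, S') \<leftarrow> multipass stream \<alpha> \<beta> m i;
     (T, T') \<leftarrow> randomized_local_search (stream (Suc i)) S \<alpha> (\<beta> (Suc i)) m;
     return_pmf (T, if f S' < f T' then T' else S') }"

end

end

theory Submission
  imports Defs
begin

text \<open>
  Fix a pass and let \<open>A\<close> consist of its initial solution and all elements that it ever draws
  from the buffer. Every swap pays for the incremental values that it removes: removing total
  value \<open>c\<close> raises \<open>f S\<close> by at least \<open>\<alpha> + \<beta> c\<close>. Hence the total removed value \<open>r\<close> satisfies
  \<open>\<beta> r \<le> f S - f S0\<close>, and \<open>f A \<le> f S + r\<close>.

  A rejected element of \<open>OPT\<close> has marginal value less than \<open>\<alpha>\<close> plus \<open>1 + \<beta>\<close> times a sum of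
  charges, one for each matroid in which it conflicts. In each matroid and for each threshold
  \<open>t\<close>, the rejected elements with charge at least \<open>t\<close> remain in the span of the solution elements
  of incremental value at least \<open>t\<close> together with the elements that were removed, with value at
  least \<open>t\<close>, because of another matroid. Comparing cardinalities for all \<open>t\<close> bounds the charges
  by \<open>p f S + (p - 1) r\<close>. The elements of \<open>OPT\<close> left in the buffer are handled by the offline
  algorithm, so \<open>f (OPT \<union> A)\<close> is bounded from above.

  From below, every draw hits a given element with probability at most \<open>1 / m\<close> and raises \<open>f S\<close>
  by \<open>\<alpha>\<close>. Therefore no element lies in \<open>A\<close> with probability greater than
  \<open>f OPT / (\<alpha> m) \<le> \<epsilon> / 2\<close>, whence \<open>f (OPT \<union> A)\<close> has expectation at least \<open>(1 - \<epsilon> / 2) f OPT\<close>.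
\<close>

lemma ex_max_if_finite_image:
  fixes g :: "'a \<Rightarrow> 'b :: linorder"
  assumes "finite (g ` A)" "A \<noteq> {}"
  shows "\<exists>x\<in>A. \<forall>y\<in>A. g y \<le> g x"
proof -
  have "Max (g ` A) \<in> g ` A" using assms by (intro Max_in) auto
  then obtain x where "x \<in> A" "Max (g ` A) = g x" by blast
  then show ?thesis using Max_ge[OF assms(1)] by force
qed

section \<open>Matroid span\<close>

text \<open>The closure of \<open>T\<close>, expressed by independent sets instead of ranks: besides
  \<open>T\<close> itself it holds every \<open>x\<close> that closes a circuit with elements of
  \<open>T\<close>. In a matroid, loops and elements outside the carrier lie in every span.\<close>

definition matroid_span :: "'a set set \<Rightarrow> 'a set \<Rightarrow> 'a set" where
  "matroid_span J T = T \<union> {x. \<exists>K\<subseteq>T. K \<in> J \<and> insert x K \<notin> J}"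

lemma matroid_spanI: "K \<subseteq> T \<Longrightarrow> K \<in> J \<Longrightarrow> insert x K \<notin> J \<Longrightarrow> x \<in> matroid_span J T"
  unfolding matroid_span_def by blast

lemma matroid_span_mono: "T \<subseteq> U \<Longrightarrow> matroid_span J T \<subseteq> matroid_span J U"
  unfolding matroid_span_def by blast

context
  fixes E :: "'a set" and J :: "'a set set"
  assumes M: "matroid E J"
begin

lemma matroid_finite: "finite E" and matroid_carrier: "A \<in> J \<Longrightarrow> A \<subseteq> E"
  and matroid_subset: "B \<in> J \<Longrightarrow> A \<subseteq> B \<Longrightarrow> A \<in> J" and matroid_empty: "{} \<in> J"
  and matroid_augment: "A \<in> J \<Longrightarrow> B \<in> J \<Longrightarrow> card A < card B \<Longrightarrow> \<exists>e\<in>B - A. insert e A \<in> J"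
  using M unfolding matroid_def by blast+

lemma matroid_indep_finite: "A \<in> J \<Longrightarrow> finite A"
  using matroid_finite matroid_carrier finite_subset by blast

lemma matroid_extend:
  assumes "A \<in> J" "B \<in> J" "card A \<le> card B"
  shows "\<exists>C. A \<subseteq> C \<and> C \<subseteq> A \<union> B \<and> C \<in> J \<and> card C = card B"
  using assms
proof (induction "card B - card A" arbitrary: A)
  case 0
  then show ?case by (intro exI[of _ A]) auto
next
  case (Suc n)
  then obtain e where e: "e \<in> B - A" "insert e A \<in> J"
    using matroid_augment[of A B] by fastforce
  have c: "card (insert e A) = Suc (card A)"
    using e Suc.prems matroid_indep_finite by simp
  have "\<exists>C. insert e A \<subseteq> C \<and> C \<subseteq> insert e A \<union> B \<and> C \<in> J \<and> card C = card B"
    using Suc e c by (intro Suc.hyps(1)) auto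
  then show ?case using e by blast
qed

definition matroid_basis :: "'a set \<Rightarrow> 'a set \<Rightarrow> bool" where
  "matroid_basis T B \<longleftrightarrow> B \<subseteq> T \<and> B \<in> J \<and> (\<forall>K\<subseteq>T. K \<in> J \<longrightarrow> card K \<le> card B)"

lemma matroid_basis_exists: "\<exists>B. matroid_basis T B"
proof -
  have "finite (card ` {K. K \<subseteq> T \<and> K \<in> J})"
    using matroid_finite matroid_carrier
    by (intro finite_imageI) (rule finite_subset[of _ "Pow E"], auto)
  moreover have "{K. K \<subseteq> T \<and> K \<in> J} \<noteq> {}"
    using matroid_empty by blast
  ultimately have "\<exists>B\<in>{K. K \<subseteq> T \<and> K \<in> J}. \<forall>K\<in>{K. K \<subseteq> T \<and> K \<in> J}. card K \<le> card B"
    by (rule ex_max_if_finite_image)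
  then show ?thesis unfolding matroid_basis_def by blast
qed

text \<open>A larger \<open>R\<close> would augment \<open>B\<close> by some \<open>e\<close>, and
  \<open>e\<close> lies outside \<open>T\<close> because \<open>B\<close> is largest there, so
  \<open>e\<close> depends on an independent \<open>K\<close> inside \<open>T\<close>. Now extend
  \<open>K\<close> from \<open>insert e B\<close> to size \<open>card B + 1\<close>. With
  \<open>e\<close>, the result contains the dependent set \<open>insert e K\<close>; without
  \<open>e\<close>, it is an independent subset of \<open>T\<close> larger than
  \<open>B\<close>.\<close>

lemma card_le_matroid_basis:
  assumes B: "matroid_basis T B" and R: "R \<in> J" "R \<subseteq> matroid_span J T"
  shows "card R \<le> card B"
proof (rule ccontr)
  assume "\<not> ?thesis"
  then obtain e where e: "e \<in> R" "e \<notin> B" "insert e B \<in> J"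
    using matroid_augment[of B R] B R by (auto simp: matroid_basis_def)
  have fB: "finite B" using B matroid_indep_finite by (auto simp: matroid_basis_def)
  have ceB: "card (insert e B) = Suc (card B)" using e fB by simp
  have "e \<notin> T"
  proof
    assume "e \<in> T"
    then have "card (insert e B) \<le> card B" using B e unfolding matroid_basis_def by blast
    then show False using ceB by simp
  qed
  then obtain K where K: "K \<subseteq> T" "K \<in> J" "insert e K \<notin> J"
    using e R unfolding matroid_span_def by blast
  have "card K \<le> card B" using K B unfolding matroid_basis_def by blast
  then obtain C where C: "K \<subseteq> C" "C \<subseteq> K \<union> insert e B" "C \<in> J" "card C = Suc (card B)"
    using matroid_extend[OF K(2) e(3)] ceB by auto
  show False
  proof (cases "e \<in> C")
    case True
    then show False using K C matroid_subset[of C "insert e K"] by blast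
  next
    case False
    then have "C \<subseteq> T" using C K B unfolding matroid_basis_def by blast
    then have "card C \<le> card B" using B C unfolding matroid_basis_def by blast
    then show False using C by simp
  qed
qed

lemma card_le_of_subset_span:
  assumes "R \<in> J" "R \<subseteq> matroid_span J T" "finite T"
  shows "card R \<le> card T"
proof -
  obtain B where B: "matroid_basis T B" using matroid_basis_exists by blast
  then have "card B \<le> card T" using assms card_mono unfolding matroid_basis_def by blast
  then show ?thesis using card_le_matroid_basis[OF B] assms by force
qed

text \<open>If \<open>x\<close> were outside the span of \<open>U\<close>, a basis \<open>B\<close>
  of \<open>U\<close> would stay independent together with \<open>x\<close>. Since \<open>x\<close>
  depends on some \<open>K\<close> inside \<open>T\<close>, an extension of \<open>K\<close> from
  \<open>insert x B\<close> to the size of \<open>insert x B\<close> has to avoid \<open>x\<close>.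
  It then lies in the span of \<open>U\<close> and has more elements than \<open>B\<close>.\<close>

lemma matroid_span_trans:
  assumes TU: "T \<subseteq> matroid_span J U"
  shows "matroid_span J T \<subseteq> matroid_span J U"
proof
  fix x assume x: "x \<in> matroid_span J T"
  show "x \<in> matroid_span J U"
  proof (rule ccontr)
    assume nx: "x \<notin> matroid_span J U"
    obtain B where B: "matroid_basis U B" using matroid_basis_exists by blast
    have BU: "B \<subseteq> U" and BJ: "B \<in> J" using B unfolding matroid_basis_def by auto
    have xB: "insert x B \<in> J" "x \<notin> B" using nx BU BJ unfolding matroid_span_def by auto
    have cxB: "card (insert x B) = Suc (card B)" using xB BJ matroid_indep_finite by simp
    obtain K where K: "K \<subseteq> T" "K \<in> J" "insert x K \<notin> J"
      using x nx TU unfolding matroid_span_def by blast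
    have "card K \<le> card B" using card_le_matroid_basis[OF B K(2)] K TU by blast
    then obtain C where C: "K \<subseteq> C" "C \<subseteq> K \<union> insert x B" "C \<in> J" "card C = Suc (card B)"
      using matroid_extend[OF K(2) xB(1)] cxB by auto
    have "x \<notin> C" using K C matroid_subset[of C "insert x K"] by blast
    then have "C \<subseteq> K \<union> B" using C by blast
    also have "\<dots> \<subseteq> matroid_span J U" using K TU BU unfolding matroid_span_def by blast
    finally have "card C \<le> card B" using card_le_matroid_basis[OF B C(3)] by blast
    then show False using C by simp
  qed
qed

text \<open>The set is the fundamental circuit of \<open>x\<close> in \<open>S\<close>. Were it
  independent, it would extend inside \<open>insert x S\<close> to size \<open>card S\<close> and
  thus omit exactly one \<open>y\<close> of \<open>S\<close>. Then \<open>y\<close> can be swapped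
  for \<open>x\<close>, so \<open>y\<close> is in the circuit after all.\<close>

lemma fundamental_circuit_dependent:
  assumes S: "S \<in> J" "insert x S \<notin> J"
  shows "insert x {y \<in> S. insert x (S - {y}) \<in> J} \<notin> J" (is "insert x ?T \<notin> J")
proof
  assume T: "insert x ?T \<in> J"
  have x: "x \<notin> S" using S by (metis insert_absorb)
  have fS: "finite S" using S matroid_indep_finite by blast
  have "?T \<noteq> S" using T S by auto
  then have "card ?T < card S" using fS by (intro psubset_card_mono) auto
  then have "card (insert x ?T) \<le> card S" using fS x by (simp add: card_insert_if)
  then obtain C where C: "insert x ?T \<subseteq> C" "C \<subseteq> insert x ?T \<union> S" "C \<in> J" "card C = card S"
    using matroid_extend[OF T S(1)] by auto
  have fC: "finite C" using C matroid_indep_finite by blast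
  have "card (C - {x}) = card S - 1" using C fC by auto
  moreover have CS: "C - {x} \<subseteq> S" using C by blast
  ultimately have "C - {x} \<noteq> S" using \<open>card ?T < card S\<close> by auto
  then obtain y where y: "y \<in> S" "y \<notin> C" using CS x by blast
  have "C - {x} = S - {y}"
    using CS y fS C fC \<open>card (C - {x}) = card S - 1\<close>
    by (intro card_subset_eq) auto
  then have "insert x (S - {y}) = C" using C by blast
  then have "y \<in> ?T" using y C by auto
  then show False using y C by blast
qed

end

section \<open>Comparison of sums by level sets\<close>

text \<open>A discrete layer-cake comparison. The largest \<open>a x\<close>, if positive, is
  matched with some \<open>y\<close> whose \<open>b y\<close> is at least as large, and both are
  removed. Every level up to \<open>a x\<close> loses one element on each side, and above
  \<open>a x\<close> there is no element of \<open>R\<close>.\<close>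

lemma sum_le_by_level_sets:
  fixes a :: "'a \<Rightarrow> real" and b :: "'b \<Rightarrow> real"
  assumes "finite R" "finite T" and "\<And>y. y \<in> T \<Longrightarrow> 0 \<le> b y"
    and "\<And>t. 0 < t \<Longrightarrow> card {x\<in>R. t \<le> a x} \<le> card {y\<in>T. t \<le> b y}"
  shows "sum a R \<le> sum b T"
  using assms
proof (induction "card R" arbitrary: R T)
  case 0
  then show ?case by (simp add: sum_nonneg)
next
  case (Suc n)
  have "R \<noteq> {}" using Suc by auto
  then obtain x where x: "x \<in> R" "\<And>z. z \<in> R \<Longrightarrow> a z \<le> a x"
    using ex_max_if_finite_image[of a R, OF finite_imageI[OF Suc.prems(1)] \<open>R \<noteq> {}\<close>] by auto
  show ?case
  proof (cases "a x \<le> 0")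
    case True
    then have "sum a R \<le> 0" using x(2) by (intro sum_nonpos) (rule order_trans)
    also have "0 \<le> sum b T" using Suc.prems(3) by (rule sum_nonneg)
    finally show ?thesis .
  next
    case False
    have "{z\<in>R. a x \<le> a z} \<noteq> {}" using x by auto
    then have "0 < card {z\<in>R. a x \<le> a z}" using Suc.prems(1) by (simp add: card_gt_0_iff)
    then have "0 < card {z\<in>T. a x \<le> b z}" using Suc.prems(4)[of "a x"] False by linarith
    then have "{z\<in>T. a x \<le> b z} \<noteq> {}" by (metis card.empty less_irrefl)
    then obtain y where y: "y \<in> T" "a x \<le> b y" by blast
    have "sum a (R - {x}) \<le> sum b (T - {y})"
    proof (rule Suc.hyps(1))
      show "n = card (R - {x})" using Suc.hyps(2) x Suc.prems(1) by simp
      fix t :: real assume t: "0 < t"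
      have eqs: "{z\<in>R - {x}. t \<le> a z} = {z\<in>R. t \<le> a z} - {x}"
        "{z\<in>T - {y}. t \<le> b z} = {z\<in>T. t \<le> b z} - {y}" by auto
      show "card {z\<in>R - {x}. t \<le> a z} \<le> card {z\<in>T - {y}. t \<le> b z}"
      proof (cases "t \<le> a x")
        case True
        then have "card ({z\<in>R. t \<le> a z} - {x}) = card {z\<in>R. t \<le> a z} - 1"
          "card ({z\<in>T. t \<le> b z} - {y}) = card {z\<in>T. t \<le> b z} - 1"
          using x(1) y by (auto intro!: card_Diff_singleton)
        then show ?thesis unfolding eqs using Suc.prems(4)[OF t] by simp
      next
        case False
        then have "{z\<in>R - {x}. t \<le> a z} = {}" using x(2) order_trans by blast
        then show ?thesis by (metis card.empty le0)
      qed
    qed (use Suc.prems(1-3) in auto)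
    then show ?thesis using sum.remove[OF Suc.prems(1) x(1), of a] sum.remove[OF Suc.prems(2) y(1), of b] y(2)
      by linarith
  qed
qed

section \<open>Expectations over finitely supported distributions\<close>

lemma expectation_mono_finite:
  fixes g h :: "'a \<Rightarrow> real"
  assumes "finite (set_pmf p)" "\<And>x. x \<in> set_pmf p \<Longrightarrow> g x \<le> h x"
  shows "measure_pmf.expectation p g \<le> measure_pmf.expectation p h"
  by (rule integral_mono_AE)
    (use assms in \<open>simp_all add: integrable_measure_pmf_finite AE_measure_pmf_iff\<close>)

lemma expectation_cong_finite:
  fixes g h :: "'a \<Rightarrow> real"
  assumes "\<And>x. x \<in> set_pmf p \<Longrightarrow> g x = h x"
  shows "measure_pmf.expectation p g = measure_pmf.expectation p h"
  using assms by (intro integral_cong_AE) (auto simp: AE_measure_pmf_iff)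

lemma expectation_bind_finite:
  fixes h :: "'b \<Rightarrow> real"
  assumes "finite (set_pmf p)" "\<And>x. x \<in> set_pmf p \<Longrightarrow> finite (set_pmf (k x))"
  shows "measure_pmf.expectation (bind_pmf p k) h
    = measure_pmf.expectation p (\<lambda>x. measure_pmf.expectation (k x) h)"
proof -
  have "measure_pmf.expectation (bind_pmf p k) h
      = (\<Sum>x\<in>set_pmf p. pmf p x *\<^sub>R measure_pmf.expectation (k x) h)"
    using assms by (intro pmf_expectation_bind) auto
  also have "\<dots> = measure_pmf.expectation p (\<lambda>x. measure_pmf.expectation (k x) h)"
    by (rule integral_measure_pmf[symmetric]) (use assms(1) in auto)
  finally show ?thesis .
qed

section \<open>Submodular functions\<close>

context
  fixes X :: "'a set" and f :: "'a set \<Rightarrow> real"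
  assumes sub: "submodular_on X f"
begin

text \<open>The condition \<open>e \<notin> B\<close> matters because \<open>f\<close> need not be
  monotone: for \<open>e\<close> in \<open>B\<close> the left side is 0, while the right side may be
  negative.\<close>

lemma marginal_antimono:
  assumes "A \<subseteq> B" "B \<subseteq> X" "e \<in> X" "e \<notin> B"
  shows "marginal f e B \<le> marginal f e A"
proof -
  have "f ((A \<union> {e}) \<union> B) + f ((A \<union> {e}) \<inter> B) \<le> f (A \<union> {e}) + f B"
    using sub[unfolded submodular_on_def, rule_format, of "A \<union> {e}" B] assms by simp
  moreover have "(A \<union> {e}) \<union> B = B \<union> {e}" "(A \<union> {e}) \<inter> B = A" using assms by auto
  ultimately show ?thesis unfolding marginal_def by simp
qed

lemma union_le_sum_marginal:
  assumes "finite R" "R \<subseteq> X" "A \<subseteq> X" "R \<inter> A = {}"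
  shows "f (A \<union> R) \<le> f A + (\<Sum>x\<in>R. marginal f x A)"
  using assms
proof (induction R rule: finite_induct)
  case (insert x R)
  have "marginal f x (A \<union> R) \<le> marginal f x A"
    using insert by (intro marginal_antimono) auto
  then have "f (A \<union> insert x R) \<le> f (A \<union> R) + marginal f x A"
    unfolding marginal_def by simp
  then show ?case using insert by simp
qed simp

text \<open>The induction removes an element of least probability; the term \<open>s * f (Z \<union> V)\<close> is what
  the Abel summation over the elements in order of probability leaves behind.\<close>

lemma expectation_sampled_union_aux:
  fixes D :: "'a set pmf"
  assumes nonneg: "nonneg_on X f" and fX: "finite X" and fD: "finite (set_pmf D)"
    and ZX: "Z \<subseteq> X" and VX: "V \<subseteq> X - Z"
    and q: "\<And>e. e \<in> V \<Longrightarrow> measure_pmf.expectation D (\<lambda>A. indicator A e) \<le> q"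
    and s: "\<And>e. e \<in> V \<Longrightarrow> s \<le> measure_pmf.expectation D (\<lambda>A. indicator A e)" and sq: "s \<le> q"
  shows "(1 - q) * f Z + s * f (Z \<union> V) \<le> measure_pmf.expectation D (\<lambda>A. f (Z \<union> (A \<inter> V)))"
  using VX q s sq
proof (induction "card V" arbitrary: V s)
  case 0
  then have "finite V" using fX by (meson Diff_subset finite_subset)
  then have "V = {}" using 0 by simp
  moreover have "0 \<le> f Z" using nonneg ZX unfolding nonneg_on_def by blast
  then have "s * f Z \<le> q * f Z" using 0 by (intro mult_right_mono)
  ultimately show ?case by (simp add: algebra_simps)
next
  case (Suc n)
  let ?P = "\<lambda>e. measure_pmf.expectation D (\<lambda>A. indicator A e) :: real"
  have fV: "finite V" using Suc fX finite_subset[of V X] by auto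
  have "V \<noteq> {}" using Suc by auto
  then obtain e where e: "e \<in> V" "\<And>z. z \<in> V \<Longrightarrow> ?P e \<le> ?P z"
    using ex_max_if_finite_image[of "\<lambda>e. - ?P e" V] fV by auto
  let ?W = "V - {e}"
  have IH: "(1 - q) * f Z + ?P e * f (Z \<union> ?W) \<le> measure_pmf.expectation D (\<lambda>A. f (Z \<union> (A \<inter> ?W)))"
    using Suc e fV by (intro Suc.hyps(1)) auto
  have eV: "insert e ?W = V" using e by blast
  let ?m = "f (Z \<union> V) - f (Z \<union> ?W)"
  \<comment> \<open>\<open>?m\<close> is the marginal value of \<open>e\<close> over all of
    \<open>Z \<union> ?W\<close>, hence the least that \<open>e\<close> can add to a smaller set. It
    may be negative.\<close>
  have pw: "f (Z \<union> (A \<inter> ?W)) + indicator A e * ?m \<le> f (Z \<union> (A \<inter> V))" for A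
  proof (cases "e \<in> A")
    case True
    have "marginal f e (Z \<union> ?W) \<le> marginal f e (Z \<union> (A \<inter> ?W))"
      using Suc.prems e ZX by (intro marginal_antimono) auto
    moreover have "Z \<union> ?W \<union> {e} = Z \<union> V" "Z \<union> (A \<inter> ?W) \<union> {e} = Z \<union> (A \<inter> V)" using e True by auto
    ultimately show ?thesis using True unfolding marginal_def by simp
  next
    case False
    then have "A \<inter> ?W = A \<inter> V" by auto
    then show ?thesis using False by simp
  qed
  have "measure_pmf.expectation D (\<lambda>A. f (Z \<union> (A \<inter> ?W))) + ?P e * ?m
      = measure_pmf.expectation D (\<lambda>A. f (Z \<union> (A \<inter> ?W)) + indicator A e * ?m)"
    using fD by (subst Bochner_Integration.integral_add) (auto intro!: integrable_measure_pmf_finite)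
  also have "\<dots> \<le> measure_pmf.expectation D (\<lambda>A. f (Z \<union> (A \<inter> V)))"
    using fD pw by (rule expectation_mono_finite)
  finally have "(1 - q) * f Z + ?P e * f (Z \<union> V) \<le> measure_pmf.expectation D (\<lambda>A. f (Z \<union> (A \<inter> V)))"
    using IH by (simp add: algebra_simps)
  moreover have "0 \<le> f (Z \<union> V)" using nonneg ZX Suc.prems unfolding nonneg_on_def by blast
  then have "s * f (Z \<union> V) \<le> ?P e * f (Z \<union> V)" using Suc.prems e by (intro mult_right_mono) auto
  ultimately show ?case by linarith
qed

text \<open>Only the part of \<open>A\<close> outside \<open>Z\<close> matters, so the preceding
  bound applies with \<open>V = X - Z\<close> and \<open>s = 0\<close>. It limits the loss that a
  non-monotone \<open>f\<close> suffers when the random set of drawn elements is added to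
  \<open>OPT\<close>.\<close>

lemma expectation_sampled_union:
  fixes D :: "'a set pmf"
  assumes "nonneg_on X f" "finite X" "Z \<subseteq> X" "0 \<le> q"
    and D: "\<And>A. A \<in> set_pmf D \<Longrightarrow> A \<subseteq> X"
    and q: "\<And>e. e \<in> X \<Longrightarrow> measure_pmf.expectation D (\<lambda>A. indicator A e) \<le> q"
  shows "(1 - q) * f Z \<le> measure_pmf.expectation D (\<lambda>A. f (Z \<union> A))"
proof -
  have "set_pmf D \<subseteq> Pow X" using D by auto
  then have fD: "finite (set_pmf D)" using assms(2) finite_subset by blast
  have "(1 - q) * f Z + 0 * f (Z \<union> (X - Z)) \<le> measure_pmf.expectation D (\<lambda>A. f (Z \<union> (A \<inter> (X - Z))))"
    using assms fD by (intro expectation_sampled_union_aux) auto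
  also have "\<dots> = measure_pmf.expectation D (\<lambda>A. f (Z \<union> A))"
  proof (rule expectation_cong_finite)
    fix A assume "A \<in> set_pmf D"
    then have "Z \<union> (A \<inter> (X - Z)) = Z \<union> A" using D by blast
    then show "f (Z \<union> (A \<inter> (X - Z))) = f (Z \<union> A)" by simp
  qed
  finally show ?thesis by simp
qed

section \<open>Incremental values\<close>

lemma incr_snoc_last: "x \<notin> set S \<Longrightarrow> incr f x (S @ [x]) = marginal f x (set S)"
proof -
  assume "x \<notin> set S"
  then have "takeWhile (\<lambda>t. t \<noteq> x) (S @ [x]) = S" by (induction S) auto
  then show ?thesis unfolding incr_def by simp
qed

lemma incr_snoc: "e \<in> set S \<Longrightarrow> incr f e (S @ xs) = incr f e S"
  by (simp add: incr_def takeWhile_append1)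

lemma sum_incr: "distinct S \<Longrightarrow> (\<Sum>e\<in>set S. incr f e S) = f (set S) - f {}"
proof (induction S rule: rev_induct)
  case (snoc x S)
  have "incr f x (S @ [x]) = marginal f x (set S)"
    using snoc.prems by (simp add: incr_snoc_last)
  moreover have "(\<Sum>e\<in>set S. incr f e (S @ [x])) = (\<Sum>e\<in>set S. incr f e S)"
    by (intro sum.cong) (auto simp: incr_snoc)
  ultimately show ?case using snoc by (simp add: marginal_def)
qed simp

lemma takeWhile_neq_filter_subset:
  "P e \<Longrightarrow> set (takeWhile (\<lambda>t. t \<noteq> e) (filter P S)) \<subseteq> set (takeWhile (\<lambda>t. t \<noteq> e) S)"
  by (induction S) auto

text \<open>Deleting other elements shrinks the prefix before \<open>e\<close>, and by submodularity
  the incremental value can only rise.\<close>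

lemma incr_filter_ge:
  assumes "set S \<subseteq> X" "e \<in> set S" "P e"
  shows "incr f e S \<le> incr f e (filter P S)"
  unfolding incr_def using assms takeWhile_neq_filter_subset[of P e S]
  by (intro marginal_antimono) (auto dest: set_takeWhileD)

text \<open>Both values telescope into incremental values, and those of the surviving elements do
  not decrease.\<close>

lemma filter_ge_sum_incr:
  assumes "distinct S" "set S \<subseteq> X"
  shows "f (set S) - (\<Sum>e\<in>{e\<in>set S. \<not> P e}. incr f e S) \<le> f (set (filter P S))"
proof -
  have "f (set S) - f {} = (\<Sum>e\<in>{e\<in>set S. P e}. incr f e S) + (\<Sum>e\<in>{e\<in>set S. \<not> P e}. incr f e S)"
    unfolding sum_incr[OF assms(1), symmetric]
    by (subst sum.union_disjoint[symmetric]) (auto intro!: sum.cong)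
  moreover have "(\<Sum>e\<in>{e\<in>set S. P e}. incr f e S) \<le> (\<Sum>e\<in>set (filter P S). incr f e (filter P S))"
    using assms incr_filter_ge by (auto intro!: sum_mono)
  moreover have "(\<Sum>e\<in>set (filter P S). incr f e (filter P S)) = f (set (filter P S)) - f {}"
    using assms by (intro sum_incr) simp
  ultimately show ?thesis by linarith
qed

end

section \<open>One step of the local search\<close>

text \<open>Kept apart from \<open>matchoid_search\<close> because feasibility of the solutions is
  used to derive \<open>0 < f OPT\<close>, from which the sign of \<alpha> follows.\<close>

locale matchoid_local_search = local_search L G I f sel offline
  for L :: "'l set" and G :: "'l \<Rightarrow> 'a set" and I :: "'l \<Rightarrow> 'a set set"
    and f :: "'a set \<Rightarrow> real" and sel :: "'a \<Rightarrow> 'a list \<Rightarrow> 'l \<Rightarrow> 'a"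
    and offline :: "'a set \<Rightarrow> 'a set pmf" +
  fixes X :: "'a set" and p :: nat
  assumes matchoid: "matchoid p X L G I" and min_selection: "min_selection L G I f sel"
begin

section \<open>Matchoids and the feasibility of the current solution\<close>

lemma finite_X: "finite X" and finite_L: "finite L"
  and matroid: "l \<in> L \<Longrightarrow> matroid (G l) (I l)" and G_subset: "l \<in> L \<Longrightarrow> G l \<subseteq> X"
  and card_matroids_le: "x \<in> X \<Longrightarrow> card {l\<in>L. x \<in> G l} \<le> p"
  using matchoid unfolding matchoid_def by auto

lemma finite_G: "l \<in> L \<Longrightarrow> finite (G l)"
  using G_subset finite_X finite_subset by blast

lemma feasible_indep: "feasible X L G I S \<Longrightarrow> l \<in> L \<Longrightarrow> S \<inter> G l \<in> I l"
  unfolding feasible_def by blast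

lemma indep_subset: "l \<in> L \<Longrightarrow> B \<in> I l \<Longrightarrow> A \<subseteq> B \<Longrightarrow> A \<in> I l"
  using matroid_subset[OF matroid] by blast

lemma feasible_subset: "feasible X L G I B \<Longrightarrow> A \<subseteq> B \<Longrightarrow> feasible X L G I A"
  unfolding feasible_def by (meson Int_mono indep_subset order_refl order_trans)

lemma feasible_empty: "feasible X L G I {}"
  using matroid_empty[OF matroid] unfolding feasible_def by auto

lemma sel_swaps:
  assumes "l \<in> L" "conflicts G I x S l" "swaps G I x S l \<noteq> {}"
  shows "sel x S l \<in> swaps G I x S l"
    and "\<And>y. y \<in> swaps G I x S l \<Longrightarrow> incr f (sel x S l) S \<le> incr f y S"
  using min_selection assms unfolding min_selection_def is_arg_min_def by (blast, force)

text \<open>In each conflicting matroid the removal of the selected element alone restores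
  independence. The elements removed because of other matroids only make the set smaller.\<close>

lemma feasible_insert_sol:
  assumes S: "feasible X L G I (set S)" and x: "x \<in> X" and px: "passes \<alpha> \<beta> S x"
  shows "feasible X L G I (set (insert_sol x S))"
  unfolding feasible_def
proof (intro conjI ballI)
  have T: "set (insert_sol x S) = insert x (set S - exchange x S)"
    unfolding insert_sol_def by auto
  show "set (insert_sol x S) \<subseteq> X" unfolding T using x S by (auto simp: feasible_def)
  fix l assume l: "l \<in> L"
  consider "conflicts G I x S l" | "x \<in> G l" "insert x (set S \<inter> G l) \<in> I l" | "x \<notin> G l"
    unfolding conflicts_def by blast
  then show "set (insert_sol x S) \<inter> G l \<in> I l"
  proof cases
    case 1
    then have "swaps G I x S l \<noteq> {}" and e: "sel x S l \<in> exchange x S"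
      using px l unfolding passes_def exchange_def by auto
    then have "insert x (set S \<inter> G l - {sel x S l}) \<in> I l"
      using sel_swaps(1)[OF l 1] unfolding swaps_def by simp
    then show ?thesis by (rule indep_subset[OF l]) (use e in \<open>auto simp: T\<close>)
  next
    case 2
    from 2(2) show ?thesis by (rule indep_subset[OF l]) (auto simp: T)
  next
    case 3
    show ?thesis by (rule indep_subset[OF l feasible_indep[OF S l]]) (use 3 in \<open>auto simp: T\<close>)
  qed
qed

text \<open>The invariant is that every buffered element passes the test against the current
  solution. A flush may draw any of them, and its filter restores the invariant.\<close>

lemma process_feasible:
  assumes "set xs \<subseteq> X" "feasible X L G I (set S)" "B \<subseteq> X" "\<And>y. y \<in> B \<Longrightarrow> passes \<alpha> \<beta> S y"
    and "(T, C) \<in> set_pmf (process \<alpha> \<beta> m xs (S, B))"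
  shows "feasible X L G I (set T)"
  using assms
proof (induction xs arbitrary: S B)
  case (Cons x xs)
  obtain S' B' where s: "(S', B') \<in> set_pmf (arrive \<alpha> \<beta> m x (S, B))"
    "(T, C) \<in> set_pmf (process \<alpha> \<beta> m xs (S', B'))"
    using Cons.prems(5) by auto
  have fin: "finite (insert x B)" using Cons.prems(3) finite_X finite_subset by blast
  have "feasible X L G I (set S') \<and> B' \<subseteq> X \<and> (\<forall>y\<in>B'. passes \<alpha> \<beta> S' y)"
  proof (cases "passes \<alpha> \<beta> S x \<and> card (insert x B) = m")
    case True
    then obtain y where y: "y \<in> insert x B" "S' = insert_sol y S"
      "B' = {z \<in> insert x B - {y}. passes \<alpha> \<beta> (insert_sol y S) z}"
      using s(1) set_pmf_of_set[OF insert_not_empty fin] unfolding arrive_def flush_def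
      by (auto simp: Let_def)
    then have "y \<in> X" "passes \<alpha> \<beta> S y" using True Cons.prems by auto
    then show ?thesis using feasible_insert_sol[OF Cons.prems(2)] y Cons.prems(1,3) by auto
  next
    case False
    then show ?thesis using s(1) Cons.prems unfolding arrive_def by (auto split: if_splits)
  qed
  then show ?case using Cons.IH[of S' B'] Cons.prems(1) s(2) by simp
qed simp

lemma multipass_feasible:
  assumes "\<forall>j\<in>{1..d}. set (stream j) = X" "j \<le> d"
    and "(S, S') \<in> set_pmf (multipass stream \<alpha> \<beta> m j)"
  shows "feasible X L G I (set S)"
  using assms(2,3)
proof (induction j arbitrary: S S')
  case 0
  then show ?case using feasible_empty by simp
next
  case (Suc j)
  then obtain S0 S0' B where s: "(S0, S0') \<in> set_pmf (multipass stream \<alpha> \<beta> m j)"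
    "(S, B) \<in> set_pmf (process \<alpha> (\<beta> (Suc j)) m (stream (Suc j)) (S0, {}))"
    unfolding multipass.simps randomized_local_search_def by auto
  have "feasible X L G I (set S0)" using Suc.IH[OF _ s(1)] Suc.prems(1) by simp
  then show ?case
    using process_feasible[OF _ _ _ _ s(2)] assms(1) Suc.prems(1) by simp
qed

end

text \<open>Positivity of \<alpha> is tied to a non-empty feasible set: if there is none, then
  \<open>k = 0\<close> and division by zero gives \<alpha> the value 0.\<close>

locale matchoid_search = matchoid_local_search L G I f sel offline X p
  for L :: "'l set" and G :: "'l \<Rightarrow> 'a set" and I :: "'l \<Rightarrow> 'a set set"
    and f :: "'a set \<Rightarrow> real" and sel :: "'a \<Rightarrow> 'a list \<Rightarrow> 'l \<Rightarrow> 'a"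
    and offline :: "'a set \<Rightarrow> 'a set pmf" and X :: "'a set" and p :: nat +
  fixes OPT :: "'a set" and m :: nat and \<alpha> :: real
  assumes nonneg: "nonneg_on X f"
    and submodular: "submodular_on X f"
    and OPT_feasible: "feasible X L G I OPT"
    and alpha_nonneg: "0 \<le> \<alpha>"
    and alpha_pos: "feasible X L G I S \<Longrightarrow> S \<noteq> {} \<Longrightarrow> 0 < \<alpha>"
begin

text \<open>As \<open>f\<close> need not be monotone, incremental values are not automatically
  non-negative. That they are is an invariant of the search, and it makes all charges
  non-negative.\<close>

definition good :: "'a list \<Rightarrow> bool" where
  "good S \<longleftrightarrow> distinct S \<and> feasible X L G I (set S) \<and> (\<forall>e\<in>set S. 0 \<le> incr f e S)"

lemma good_distinct: "good S \<Longrightarrow> distinct S" and good_feasible: "good S \<Longrightarrow> feasible X L G I (set S)"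
  and good_subset: "good S \<Longrightarrow> set S \<subseteq> X" and good_incr: "good S \<Longrightarrow> e \<in> set S \<Longrightarrow> 0 \<le> incr f e S"
  unfolding good_def feasible_def by auto

lemma good_Nil: "good []"
  unfolding good_def using feasible_empty by simp

lemma finite_good: "finite {S. good S}"
  by (rule finite_subset[OF _ finite_subset_distinct[OF finite_X]])
    (use good_subset good_distinct in auto)

section \<open>Circuits and the charges of rejected elements\<close>

lemma swaps_dependent:
  assumes "good S" "l \<in> L" "conflicts G I x S l"
  shows "insert x (swaps G I x S l) \<notin> I l"
  using fundamental_circuit_dependent[OF matroid, of l "set S \<inter> G l" x] assms
    feasible_indep[OF good_feasible]
  unfolding conflicts_def swaps_def by blast

text \<open>An empty \<open>swaps\<close> would make \<open>x\<close> a loop, but \<open>OPT\<close>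
  is feasible and contains no loops.\<close>

lemma OPT_swaps_nonempty:
  assumes "good S" "l \<in> L" "conflicts G I x S l" "x \<in> OPT"
  shows "swaps G I x S l \<noteq> {}"
proof
  assume "swaps G I x S l = {}"
  then have "{x} \<notin> I l" using swaps_dependent[OF assms(1-3)] by simp
  moreover have "{x} \<subseteq> OPT \<inter> G l" using assms unfolding conflicts_def by auto
  ultimately show False
    using indep_subset[OF assms(2)] feasible_indep[OF OPT_feasible assms(2)] by blast
qed

text \<open>An element of the solution has no conflict and marginal value 0, so it would pass only
  if \<alpha> were at most 0.\<close>

lemma passes_not_in:
  assumes "good S" "passes \<alpha> \<beta> S x"
  shows "x \<notin> set S"
proof
  assume x: "x \<in> set S"
  have "\<not> conflicts G I x S l" if "l \<in> L" for l
    using feasible_indep[OF good_feasible[OF assms(1)] that] x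
    unfolding conflicts_def by (metis Int_iff insert_absorb)
  then have "exchange x S = {}" unfolding exchange_def by blast
  then have "\<alpha> \<le> marginal f x (set S)" using assms(2) unfolding passes_def by simp
  also have "\<dots> = 0" using x by (simp add: marginal_def insert_absorb)
  finally show False using alpha_pos[OF good_feasible[OF assms(1)]] x by fastforce
qed

text \<open>The span argument in the matroid \<open>l\<close> breaks down for an element that leaves the solution
  because of another matroid. Such an element is kept as a dead element of \<open>l\<close>, and \<open>d l e\<close>
  records the largest incremental value with which \<open>e\<close> died in \<open>l\<close>.\<close>

definition level :: "('l \<Rightarrow> 'a \<Rightarrow> real) \<Rightarrow> 'a list \<Rightarrow> 'l \<Rightarrow> real \<Rightarrow> 'a set" where
  "level d S l t = {e \<in> G l. (e \<in> set S \<and> t \<le> incr f e S) \<or> t \<le> d l e}"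

text \<open>\<open>c l\<close> records the value of the element selected in the matroid
  \<open>l\<close> at the time of the rejection, and 0 if there was no conflict. The marginal value
  is taken over \<open>A\<close>, which never shrinks, so that the inequality survives later
  swaps.\<close>

definition charged :: "real \<Rightarrow> ('l \<Rightarrow> 'a \<Rightarrow> real) \<Rightarrow> 'a set \<Rightarrow> 'a list \<Rightarrow> 'a \<Rightarrow> bool" where
  "charged \<beta> d A S x \<longleftrightarrow> (\<exists>c. (\<forall>l. 0 \<le> c l) \<and>
     marginal f x A \<le> \<alpha> + (1 + \<beta>) * (\<Sum>l\<in>{l\<in>L. x \<in> G l}. c l) \<and>
     (\<forall>l\<in>L. x \<in> G l \<longrightarrow> 0 < c l \<longrightarrow> x \<in> matroid_span (I l) (level d S l (c l))))"

text \<open>The failed test gives the inequality. The selected element is the cheapest one in the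
  circuit of \<open>x\<close>, so the rest of this circuit lies in the level set at
  \<open>c l\<close> and spans \<open>x\<close>.\<close>

lemma rejected_charged:
  assumes "0 < \<beta>" "good S" "x \<in> OPT" "\<not> passes \<alpha> \<beta> S x" "set S \<subseteq> A" "A \<subseteq> X" "x \<notin> A"
  shows "charged \<beta> d A S x"
proof -
  let ?c = "\<lambda>l. if l \<in> L \<and> conflicts G I x S l then incr f (sel x S l) S else 0"
  let ?M = "{l\<in>L. conflicts G I x S l}"
  have ne: "swaps G I x S l \<noteq> {}" if "l \<in> L" "conflicts G I x S l" for l
    using OPT_swaps_nonempty assms that by blast
  have selS: "sel x S l \<in> set S" if "l \<in> L" "conflicts G I x S l" for l
    using sel_swaps(1)[OF that ne[OF that]] unfolding swaps_def by blast
  have c0: "0 \<le> ?c l" for l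
    using good_incr[OF assms(2)] selS by simp
  \<comment> \<open>One element may be selected in several matroids. Counting it once per matroid
    only increases the sum, because its value is non-negative.\<close>
  have "(\<Sum>e\<in>exchange x S. incr f e S) \<le> (\<Sum>l\<in>?M. incr f (sel x S l) S)"
  proof -
    have "exchange x S = (\<lambda>l. sel x S l) ` ?M" unfolding exchange_def by auto
    moreover have "(\<Sum>e\<in>sel x S ` ?M. incr f e S) \<le> sum ((\<lambda>e. incr f e S) \<circ> sel x S) ?M"
      by (rule sum_image_le) (use finite_L good_incr[OF assms(2)] selS in auto)
    ultimately show ?thesis by simp
  qed
  also have "\<dots> = (\<Sum>l\<in>?M. ?c l)" by simp
  also have "\<dots> \<le> (\<Sum>l\<in>{l\<in>L. x \<in> G l}. ?c l)"
    using finite_L c0 by (intro sum_mono2) (auto simp: conflicts_def)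
  finally have C: "(\<Sum>e\<in>exchange x S. incr f e S) \<le> (\<Sum>l\<in>{l\<in>L. x \<in> G l}. ?c l)" .
  have "x \<in> X" using assms OPT_feasible unfolding feasible_def by blast
  then have "marginal f x A \<le> marginal f x (set S)"
    using assms by (intro marginal_antimono[OF submodular]) auto
  also have "\<dots> \<le> \<alpha> + (1 + \<beta>) * (\<Sum>e\<in>exchange x S. incr f e S)"
    using assms(4) ne unfolding passes_def by auto
  also have "\<dots> \<le> \<alpha> + (1 + \<beta>) * (\<Sum>l\<in>{l\<in>L. x \<in> G l}. ?c l)"
    using C assms(1) by (intro add_left_mono mult_left_mono) auto
  finally have m: "marginal f x A \<le> \<alpha> + (1 + \<beta>) * (\<Sum>l\<in>{l\<in>L. x \<in> G l}. ?c l)" .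
  have "x \<in> matroid_span (I l) (level d S l (?c l))" if l: "l \<in> L" "0 < ?c l" for l
  proof -
    have cf: "conflicts G I x S l" using l by (auto split: if_splits)
    have "swaps G I x S l \<subseteq> level d S l (?c l)"
      using sel_swaps(2)[OF l(1) cf ne[OF l(1) cf]] l cf unfolding swaps_def level_def by auto
    moreover have "swaps G I x S l \<in> I l"
      by (rule indep_subset[OF l(1) feasible_indep[OF good_feasible[OF assms(2)] l(1)]])
        (auto simp: swaps_def)
    ultimately show ?thesis
      using swaps_dependent[OF assms(2) l(1) cf] by (rule matroid_spanI)
  qed
  then show ?thesis unfolding charged_def using c0 m by (intro exI[of _ ?c]) blast
qed

section \<open>The effect of a single swap\<close>

context
  fixes \<beta> :: real and S :: "'a list" and x :: 'a
  assumes beta: "0 < \<beta>" and S: "good S" and x: "x \<in> X" and px: "passes \<alpha> \<beta> S x"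
begin

lemma selected:
  assumes "l \<in> L" "conflicts G I x S l"
  shows "sel x S l \<in> swaps G I x S l"
    and "\<And>y. y \<in> swaps G I x S l \<Longrightarrow> incr f (sel x S l) S \<le> incr f y S"
    and "sel x S l \<in> exchange x S"
  using sel_swaps[OF assms] px assms unfolding passes_def exchange_def by blast+

lemma exchange_subset: "exchange x S \<subseteq> set S"
  using selected(1) unfolding exchange_def swaps_def by blast

lemma exchange_incr_nonneg: "e \<in> exchange x S \<Longrightarrow> 0 \<le> incr f e S"
  using good_incr[OF S] exchange_subset by blast

lemma exchange_sum_nonneg: "0 \<le> (\<Sum>e\<in>exchange x S. incr f e S)"
  using exchange_incr_nonneg by (rule sum_nonneg)

lemma exchange_incr_le: "e \<in> exchange x S \<Longrightarrow> incr f e S \<le> (\<Sum>e\<in>exchange x S. incr f e S)"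
  using exchange_incr_nonneg finite_subset[OF exchange_subset] by (intro member_le_sum) auto

lemma insert_sol_eq: "insert_sol x S = filter (\<lambda>y. y \<notin> exchange x S) S @ [x]"
  using passes_not_in[OF S px] unfolding insert_sol_def by (auto intro: filter_cong)

lemma set_insert_sol: "set (insert_sol x S) = insert x (set S - exchange x S)"
  unfolding insert_sol_eq by auto

lemma marginal_passes: "\<alpha> + (1 + \<beta>) * (\<Sum>e\<in>exchange x S. incr f e S) \<le> marginal f x (set S)"
  using px unfolding passes_def by blast

lemma marginal_ge_sum: "\<alpha> + (\<Sum>e\<in>exchange x S. incr f e S) \<le> marginal f x (set S)"
proof -
  have "0 \<le> \<beta> * (\<Sum>e\<in>exchange x S. incr f e S)" using beta exchange_sum_nonneg by simp
  then show ?thesis using marginal_passes by (simp add: algebra_simps)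
qed

lemma incr_insert_sol_old:
  assumes "e \<in> set S" "e \<notin> exchange x S"
  shows "incr f e S \<le> incr f e (insert_sol x S)"
  unfolding insert_sol_eq using assms incr_filter_ge[OF submodular good_subset[OF S]]
  by (subst incr_snoc[OF submodular]) auto

lemma marginal_le_without_exchange: "marginal f x (set S) \<le> marginal f x (set S - exchange x S)"
  by (rule marginal_antimono[OF submodular Diff_subset good_subset[OF S] x passes_not_in[OF S px]])

lemma incr_insert_sol_new: "marginal f x (set S) \<le> incr f x (insert_sol x S)"
proof -
  have "set (filter (\<lambda>y. y \<notin> exchange x S) S) = set S - exchange x S" by auto
  then show ?thesis
    unfolding insert_sol_eq using passes_not_in[OF S px] marginal_le_without_exchange
    by (subst incr_snoc_last[OF submodular]) auto
qed

lemma value_insert_sol: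
  "f (set S) + marginal f x (set S) - (\<Sum>e\<in>exchange x S. incr f e S) \<le> f (set (insert_sol x S))"
proof -
  have "{e \<in> set S. \<not> e \<notin> exchange x S} = exchange x S" using exchange_subset by auto
  moreover have "set (filter (\<lambda>y. y \<notin> exchange x S) S) = set S - exchange x S" by auto
  ultimately have "f (set S) - (\<Sum>e\<in>exchange x S. incr f e S) \<le> f (set S - exchange x S)"
    using filter_ge_sum_incr[OF submodular good_distinct[OF S] good_subset[OF S], of "\<lambda>e. e \<notin> exchange x S"]
    by simp
  moreover have "f (set (insert_sol x S)) = f (set S - exchange x S) + marginal f x (set S - exchange x S)"
    unfolding set_insert_sol marginal_def by simp
  ultimately show ?thesis using marginal_le_without_exchange by linarith
qed

text \<open>Of the \<open>1 + \<beta>\<close> copies of the removed value that the test guarantees,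
  one pays for the loss; the other \<beta> copies and \<alpha> remain as gain.\<close>

lemma value_insert_sol_gain:
  "f (set S) + \<alpha> + \<beta> * (\<Sum>e\<in>exchange x S. incr f e S) \<le> f (set (insert_sol x S))"
  using value_insert_sol marginal_passes by (simp add: algebra_simps)

lemma good_insert_sol: "good (insert_sol x S)"
  unfolding good_def
proof (intro conjI ballI)
  show "distinct (insert_sol x S)"
    unfolding insert_sol_eq using good_distinct[OF S] passes_not_in[OF S px] by auto
  show "feasible X L G I (set (insert_sol x S))"
    by (rule feasible_insert_sol[OF good_feasible[OF S] x px])
  fix e assume "e \<in> set (insert_sol x S)"
  then consider "e = x" | "e \<in> set S" "e \<notin> exchange x S" unfolding set_insert_sol by blast
  then show "0 \<le> incr f e (insert_sol x S)"
  proof cases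
    case 1
    show ?thesis unfolding 1
      using incr_insert_sol_new marginal_ge_sum exchange_sum_nonneg alpha_nonneg by linarith
  next
    case 2
    then show ?thesis using incr_insert_sol_old good_incr[OF S] by fastforce
  qed
qed

section \<open>Dead elements and the spans after a swap\<close>

definition dies :: "'l \<Rightarrow> 'a \<Rightarrow> bool" where
  "dies l e \<longleftrightarrow> e \<in> exchange x S \<and> \<not> (conflicts G I x S l \<and> e = sel x S l)"

text \<open>The maximum covers an element that is removed, arrives again and is removed once more:
  the larger value keeps it in every level set in which it was before.\<close>

definition dead_update :: "('l \<Rightarrow> 'a \<Rightarrow> real) \<Rightarrow> 'l \<Rightarrow> 'a \<Rightarrow> real" where
  "dead_update d l e = (if dies l e then max (d l e) (incr f e S) else d l e)"

text \<open>An element \<open>e\<close> of the level set can get lost only as the one selected in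
  \<open>l\<close>. Being the cheapest in the circuit of \<open>x\<close>, it leaves behind elements
  of value at least \<open>t\<close>, each of which survives or becomes dead in \<open>l\<close>.
  Since \<open>x\<close> reaches level \<open>t\<close> too, the rest of the circuit spans
  \<open>e\<close>.\<close>

lemma level_span:
  assumes l: "l \<in> L"
  shows "level d S l t \<subseteq> matroid_span (I l) (level (dead_update d) (insert_sol x S) l t)"
    (is "_ \<subseteq> matroid_span _ ?U")
proof
  fix e assume e: "e \<in> level d S l t"
  have keep: "y \<in> ?U" if "y \<in> set S" "y \<in> G l" "t \<le> incr f y S" "y \<notin> exchange x S \<or> dies l y" for y
    using that incr_insert_sol_old[of y] unfolding level_def dead_update_def set_insert_sol by auto
  show "e \<in> matroid_span (I l) ?U"
  proof (cases "e \<in> ?U")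
    case True
    then show ?thesis unfolding matroid_span_def by blast
  next
    case False
    then have e': "e \<in> set S" "e \<in> G l" "t \<le> incr f e S"
      using e unfolding level_def dead_update_def by (auto split: if_splits)
    then have eC: "e \<in> exchange x S" and cf: "conflicts G I x S l" and es: "e = sel x S l"
      using False keep[of e] unfolding dies_def by blast+
    have esw: "e \<in> swaps G I x S l" using selected(1)[OF l cf] es by simp
    let ?K = "insert x (swaps G I x S l - {e})"
    have K: "swaps G I x S l - {e} \<subseteq> ?U"
    proof
      fix y assume y: "y \<in> swaps G I x S l - {e}"
      then have "t \<le> incr f y S" using selected(2)[OF l cf] es e'(3) by fastforce
      moreover have "y \<notin> exchange x S \<or> dies l y" using y es unfolding dies_def by blast
      ultimately show "y \<in> ?U" using y keep unfolding swaps_def by blast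
    qed
    \<comment> \<open>The value of \<open>x\<close> is at least the total value that it removes,
      hence at least that of \<open>e\<close>.\<close>
    have xU: "x \<in> ?U"
      using cf e'(3) exchange_incr_le[OF eC] marginal_ge_sum incr_insert_sol_new alpha_nonneg
      unfolding level_def set_insert_sol conflicts_def by auto
    have KI: "?K \<in> I l"
    proof -
      have "insert x (set S \<inter> G l - {e}) \<in> I l" using esw unfolding swaps_def by blast
      then show ?thesis by (rule indep_subset[OF l]) (auto simp: swaps_def)
    qed
    have "insert e ?K = insert x (swaps G I x S l)" using esw by blast
    then have "insert e ?K \<notin> I l" using swaps_dependent[OF S l cf] by simp
    then show ?thesis using K xU KI by (intro matroid_spanI[of ?K]) auto
  qed
qed

text \<open>The recorded charges need no change: a larger \<open>A\<close> lowers the marginal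
  value, and transitivity of the span moves \<open>y\<close> to the new level sets.\<close>

lemma charged_insert_sol:
  assumes "charged \<beta> d A S y" "A \<subseteq> X" "y \<in> X" "y \<notin> insert x A"
  shows "charged \<beta> (dead_update d) (insert x A) (insert_sol x S) y"
proof -
  obtain c where c: "\<forall>l. 0 \<le> c l" "marginal f y A \<le> \<alpha> + (1 + \<beta>) * (\<Sum>l\<in>{l\<in>L. y \<in> G l}. c l)"
    "\<forall>l\<in>L. y \<in> G l \<longrightarrow> 0 < c l \<longrightarrow> y \<in> matroid_span (I l) (level d S l (c l))"
    using assms(1) unfolding charged_def by blast
  have "marginal f y (insert x A) \<le> marginal f y A"
    using assms x by (intro marginal_antimono[OF submodular]) auto
  then have "marginal f y (insert x A) \<le> \<alpha> + (1 + \<beta>) * (\<Sum>l\<in>{l\<in>L. y \<in> G l}. c l)"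
    using c(2) by linarith
  moreover have "\<forall>l\<in>L. y \<in> G l \<longrightarrow> 0 < c l \<longrightarrow>
      y \<in> matroid_span (I l) (level (dead_update d) (insert_sol x S) l (c l))"
    using c(3) matroid_span_trans[OF matroid level_span] by blast
  ultimately show ?thesis unfolding charged_def using c(1) by blast
qed

lemma dead_update_nonneg: "(\<And>l e. 0 \<le> d l e) \<Longrightarrow> 0 \<le> dead_update d l e"
  unfolding dead_update_def by (simp add: max.coboundedI1)

text \<open>Each removed element is the selected one in some matroid, and hence dies in at most
  \<open>p - 1\<close> matroids.\<close>

lemma dead_update_sum:
  assumes d: "\<And>l e. 0 \<le> d l e"
  shows "(\<Sum>l\<in>L. \<Sum>e\<in>G l. dead_update d l e)
    \<le> (\<Sum>l\<in>L. \<Sum>e\<in>G l. d l e) + real (p - 1) * (\<Sum>e\<in>exchange x S. incr f e S)"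
proof -
  let ?C = "exchange x S"
  have fC: "finite ?C" using finite_subset[OF exchange_subset] by simp
  have CX: "?C \<subseteq> X" using exchange_subset good_subset[OF S] by blast
  have pw: "dead_update d l e \<le> d l e + (if dies l e then incr f e S else 0)" for l e
    using d[of l e] exchange_incr_nonneg[of e] unfolding dead_update_def dies_def by auto
  have "(\<Sum>l\<in>L. \<Sum>e\<in>G l. dead_update d l e)
      \<le> (\<Sum>l\<in>L. \<Sum>e\<in>G l. d l e + (if dies l e then incr f e S else 0))"
    using pw by (intro sum_mono)
  also have "\<dots> = (\<Sum>l\<in>L. \<Sum>e\<in>G l. d l e) + (\<Sum>l\<in>L. \<Sum>e\<in>G l. if dies l e then incr f e S else 0)"
    by (simp add: sum.distrib)
  also have "(\<Sum>l\<in>L. \<Sum>e\<in>G l. if dies l e then incr f e S else 0)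
      = (\<Sum>l\<in>L. \<Sum>e\<in>?C. if e \<in> G l \<and> dies l e then incr f e S else 0)"
  proof (rule sum.cong[OF refl])
    fix l assume "l \<in> L"
    then have "(\<Sum>e\<in>G l. if dies l e then incr f e S else 0)
        = (\<Sum>e\<in>{e\<in>G l. dies l e}. incr f e S)"
      using finite_G by (simp add: sum.inter_filter)
    also have "{e\<in>G l. dies l e} = {e\<in>?C. e \<in> G l \<and> dies l e}" unfolding dies_def by auto
    also have "(\<Sum>e\<in>{e\<in>?C. e \<in> G l \<and> dies l e}. incr f e S)
        = (\<Sum>e\<in>?C. if e \<in> G l \<and> dies l e then incr f e S else 0)"
      using fC by (simp add: sum.inter_filter)
    finally show "(\<Sum>e\<in>G l. if dies l e then incr f e S else 0)
        = (\<Sum>e\<in>?C. if e \<in> G l \<and> dies l e then incr f e S else 0)" .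
  qed
  also have "\<dots> = (\<Sum>e\<in>?C. \<Sum>l\<in>L. if e \<in> G l \<and> dies l e then incr f e S else 0)"
    by (rule sum.swap)
  also have "\<dots> = (\<Sum>e\<in>?C. real (card {l\<in>L. e \<in> G l \<and> dies l e}) * incr f e S)"
    using finite_L by (simp add: sum.inter_filter[symmetric])
  also have "\<dots> \<le> (\<Sum>e\<in>?C. real (p - 1) * incr f e S)"
  proof (intro sum_mono mult_right_mono)
    fix e assume e: "e \<in> ?C"
    then obtain l where l: "l \<in> L" "conflicts G I x S l" "e = sel x S l"
      unfolding exchange_def by blast
    then have "e \<in> G l" using selected(1) unfolding swaps_def by blast
    then have "{l\<in>L. e \<in> G l \<and> dies l e} \<subseteq> {l\<in>L. e \<in> G l} - {l}"
      using l unfolding dies_def by auto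
    then have "card {l\<in>L. e \<in> G l \<and> dies l e} \<le> card ({l\<in>L. e \<in> G l} - {l})"
      using finite_L by (intro card_mono) auto
    also have "\<dots> = card {l\<in>L. e \<in> G l} - 1" using l \<open>e \<in> G l\<close> finite_L by simp
    also have "\<dots> \<le> p - 1" using card_matroids_le[of e] e CX by auto
    finally show "real (card {l\<in>L. e \<in> G l \<and> dies l e}) \<le> real (p - 1)" by simp
  qed (use exchange_incr_nonneg in auto)
  finally show ?thesis by (simp add: sum_distrib_left)
qed

text \<open>For \<open>p = 0\<close> no element lies in any matroid. The case is singled out because
  the natural number \<open>p - 1\<close> is then 0 and not -1.\<close>

lemma exchange_empty_if_p_zero: "p = 0 \<Longrightarrow> exchange x S = {}"
proof (rule ccontr)
  assume p: "p = 0" and "exchange x S \<noteq> {}"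
  then obtain l where "l \<in> L" "x \<in> G l" unfolding exchange_def conflicts_def by blast
  then have "0 < card {l\<in>L. x \<in> G l}" using finite_L by (auto simp: card_gt_0_iff)
  then show False using card_matroids_le[OF x] p by simp
qed

end

section \<open>Accounting for a pass\<close>

text \<open>\<open>r\<close> stands for the total incremental value removed during the pass,
  \<open>d\<close> for the values of the dead elements, and \<open>R\<close> for the rejected
  elements. The clause for \<open>p = 0\<close> makes up for the truncated
  \<open>p - 1\<close>.\<close>

definition accounts :: "real \<Rightarrow> 'a list \<Rightarrow> 'a set \<Rightarrow> 'a list \<Rightarrow> 'a set \<Rightarrow> bool" where
  "accounts \<beta> S0 A S R \<longleftrightarrow> (\<exists>r d. 0 \<le> r \<and> (p = 0 \<longrightarrow> r = 0) \<and> f A \<le> f (set S) + r \<and>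
     \<beta> * r \<le> f (set S) - f (set S0) \<and> (\<forall>l e. 0 \<le> d l e) \<and>
     (\<Sum>l\<in>L. \<Sum>e\<in>G l. d l e) \<le> real (p - 1) * r \<and> (\<forall>x\<in>R. charged \<beta> d A S x))"

lemma accounts_initial: "accounts \<beta> S0 (set S0) S0 {}"
  unfolding accounts_def by (intro exI[of _ 0] exI[of _ "\<lambda>_ _. 0"]) simp

lemma accounts_reject:
  assumes "accounts \<beta> S0 A S R" "0 < \<beta>" "good S" "set S \<subseteq> A" "A \<subseteq> X"
    and "R' \<subseteq> R \<union> {x \<in> OPT - A. \<not> passes \<alpha> \<beta> S x}"
  shows "accounts \<beta> S0 A S R'"
proof -
  obtain r d where rd: "0 \<le> r \<and> (p = 0 \<longrightarrow> r = 0) \<and> f A \<le> f (set S) + r \<and>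
     \<beta> * r \<le> f (set S) - f (set S0) \<and> (\<forall>l e. 0 \<le> d l e) \<and>
     (\<Sum>l\<in>L. \<Sum>e\<in>G l. d l e) \<le> real (p - 1) * r" and R: "\<forall>x\<in>R. charged \<beta> d A S x"
    using assms(1) unfolding accounts_def by blast
  have "charged \<beta> d A S x" if "x \<in> R'" for x
  proof (cases "x \<in> R")
    case False
    then have "x \<in> OPT" "\<not> passes \<alpha> \<beta> S x" "x \<notin> A" using that assms(6) by auto
    then show ?thesis using rejected_charged[OF assms(2,3)] assms(4,5) by simp
  qed (use R in simp)
  then show ?thesis unfolding accounts_def using rd by (intro exI[of _ r] exI[of _ d]) simp
qed

lemma accounts_insert_sol:
  assumes "accounts \<beta> S0 A S R" "0 < \<beta>" "good S" "x \<in> X" "passes \<alpha> \<beta> S x"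
    and "set S \<subseteq> A" "A \<subseteq> X" "R \<subseteq> X"
  shows "accounts \<beta> S0 (insert x A) (insert_sol x S) (R - insert x A)"
proof -
  note facts = assms(2-5)
  let ?c = "\<Sum>e\<in>exchange x S. incr f e S"
  obtain r d where r: "0 \<le> r" "p = 0 \<longrightarrow> r = 0" "f A \<le> f (set S) + r"
    "\<beta> * r \<le> f (set S) - f (set S0)" and d: "\<And>l e. 0 \<le> d l e"
    "(\<Sum>l\<in>L. \<Sum>e\<in>G l. d l e) \<le> real (p - 1) * r" "\<forall>x\<in>R. charged \<beta> d A S x"
    using assms(1) unfolding accounts_def by blast
  have c0: "0 \<le> ?c" using exchange_sum_nonneg[OF facts] .
  \<comment> \<open>\<open>x\<close> may be in \<open>A\<close> already, having been removed
    earlier. Then the left side is 0, and the right side is non-negative by the test.\<close>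
  have "f (insert x A) - f A \<le> marginal f x (set S)"
  proof (cases "x \<in> A")
    case True
    then show ?thesis
      using marginal_ge_sum[OF facts] c0 alpha_nonneg by (simp add: insert_absorb)
  next
    case False
    then have "marginal f x A \<le> marginal f x (set S)"
      using assms by (intro marginal_antimono[OF submodular]) auto
    then show ?thesis unfolding marginal_def by simp
  qed
  then have "f (insert x A) \<le> f (set (insert_sol x S)) + (r + ?c)"
    using value_insert_sol[OF facts] r(3) by linarith
  moreover have "\<beta> * (r + ?c) \<le> f (set (insert_sol x S)) - f (set S0)"
    using value_insert_sol_gain[OF facts] r(4) alpha_nonneg by (simp add: algebra_simps)
  moreover have "(\<Sum>l\<in>L. \<Sum>e\<in>G l. dead_update S x d l e) \<le> real (p - 1) * (r + ?c)"
    using dead_update_sum[OF facts, of d] d by (simp add: algebra_simps)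
  moreover have "p = 0 \<longrightarrow> r + ?c = 0"
    using exchange_empty_if_p_zero[OF facts] r(2) by simp
  moreover have "\<forall>y\<in>R - insert x A. charged \<beta> (dead_update S x d) (insert x A) (insert_sol x S) y"
    using charged_insert_sol[OF facts] d(3) assms by blast
  moreover have "\<forall>l e. 0 \<le> dead_update S x d l e"
    using dead_update_nonneg[OF facts, of d] d(1) by blast
  ultimately show ?thesis unfolding accounts_def using r(1) c0
    by (intro exI[of _ "r + ?c"] exI[of _ "dead_update S x d"]) auto
qed

text \<open>For each threshold \<open>t\<close>, the elements of \<open>R\<close> with charge at
  least \<open>t\<close> are independent, as part of \<open>OPT\<close>, and lie in the span of the
  level set at \<open>t\<close>. So they are at most as many as its elements, and the comparison by
  level sets yields the sums.\<close>

lemma level_charge_bound: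
  assumes S: "good S" and l: "l \<in> L" and R: "R \<subseteq> OPT \<inter> G l"
    and d: "\<And>e. 0 \<le> d l e"
    and c: "\<And>x. x \<in> R \<Longrightarrow> 0 < c x \<Longrightarrow> x \<in> matroid_span (I l) (level d S l (c x))"
  shows "(\<Sum>x\<in>R. c x) \<le> (\<Sum>e\<in>set S \<inter> G l. incr f e S) + (\<Sum>e\<in>G l. d l e)"
proof -
  let ?b = "\<lambda>e. max (if e \<in> set S then incr f e S else 0) (d l e)"
  have RI: "R \<in> I l" using R by (rule indep_subset[OF l feasible_indep[OF OPT_feasible l]])
  have "(\<Sum>x\<in>R. c x) \<le> (\<Sum>e\<in>G l. ?b e)"
  proof (rule sum_le_by_level_sets)
    show "finite R" using R finite_G[OF l] finite_subset by blast
    show "finite (G l)" using finite_G[OF l] .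
    fix t :: real assume t: "0 < t"
    \<comment> \<open>Since \<open>t\<close> is positive, the default 0 outside the solution never
      reaches it. The maximum in \<open>?b\<close> counts an element once that is both dead and in
      the solution.\<close>
    have lev: "{e\<in>G l. t \<le> ?b e} = level d S l t"
      using t unfolding level_def by (auto simp: le_max_iff_disj)
    have "{x\<in>R. t \<le> c x} \<subseteq> matroid_span (I l) (level d S l t)"
    proof
      fix x assume x: "x \<in> {x\<in>R. t \<le> c x}"
      then have "x \<in> matroid_span (I l) (level d S l (c x))" using c t by simp
      moreover have "level d S l (c x) \<subseteq> level d S l t"
        using x unfolding level_def by auto
      ultimately show "x \<in> matroid_span (I l) (level d S l t)" using matroid_span_mono by blast
    qed
    moreover have "{x\<in>R. t \<le> c x} \<in> I l" using RI by (rule indep_subset[OF l]) auto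
    moreover have "finite (level d S l t)" using finite_G[OF l] unfolding level_def by simp
    ultimately show "card {x\<in>R. t \<le> c x} \<le> card {e\<in>G l. t \<le> ?b e}"
      unfolding lev by (intro card_le_of_subset_span[OF matroid[OF l]])
  qed (use d in \<open>simp add: max.coboundedI2\<close>)
  also have "\<dots> \<le> (\<Sum>e\<in>G l. (if e \<in> set S then incr f e S else 0) + d l e)"
  proof (rule sum_mono)
    fix e
    show "?b e \<le> (if e \<in> set S then incr f e S else 0) + d l e"
      using good_incr[OF S, of e] d[of e] by auto
  qed
  also have "\<dots> = (\<Sum>e\<in>set S \<inter> G l. incr f e S) + (\<Sum>e\<in>G l. d l e)"
  proof -
    have "(\<Sum>e\<in>G l. if e \<in> set S then incr f e S else 0) = (\<Sum>e\<in>{e\<in>G l. e \<in> set S}. incr f e S)"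
      using finite_G[OF l] by (simp add: sum.inter_filter)
    moreover have "{e\<in>G l. e \<in> set S} = set S \<inter> G l" by auto
    ultimately show ?thesis by (simp add: sum.distrib)
  qed
  finally show ?thesis .
qed

lemma sum_incr_matroids:
  assumes S: "good S"
  shows "(\<Sum>l\<in>L. \<Sum>e\<in>set S \<inter> G l. incr f e S) \<le> real p * f (set S)"
proof -
  have "(\<Sum>l\<in>L. \<Sum>e\<in>set S \<inter> G l. incr f e S) = (\<Sum>l\<in>L. \<Sum>e\<in>set S. if e \<in> G l then incr f e S else 0)"
    by (simp add: sum.inter_restrict)
  also have "\<dots> = (\<Sum>e\<in>set S. \<Sum>l\<in>L. if e \<in> G l then incr f e S else 0)"
    by (rule sum.swap)
  also have "\<dots> = (\<Sum>e\<in>set S. real (card {l\<in>L. e \<in> G l}) * incr f e S)"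
    using finite_L by (simp add: sum.inter_filter[symmetric])
  also have "\<dots> \<le> (\<Sum>e\<in>set S. real p * incr f e S)"
    using card_matroids_le good_subset[OF S] good_incr[OF S]
    by (intro sum_mono mult_right_mono) auto
  also have "\<dots> = real p * (f (set S) - f {})"
    unfolding sum_distrib_left[symmetric] sum_incr[OF submodular good_distinct[OF S]] ..
  also have "\<dots> \<le> real p * f (set S)"
    using nonneg unfolding nonneg_on_def by (intro mult_left_mono) auto
  finally show ?thesis .
qed

text \<open>The rejected elements of \<open>OPT\<close> are added to \<open>A\<close> at the price
  of their charges, those left in the buffer at the price \<open>f (OPT \<inter> B)\<close>. What
  remains of the removed value \<open>r\<close> is then paid by the increase of \<open>f\<close>
  over \<open>S0\<close>.\<close>

lemma accounts_bound:
  assumes beta: "0 < \<beta>" and S: "good S" and AX: "A \<subseteq> X" and BX: "B \<subseteq> X"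
    and acc: "accounts \<beta> S0 A S (OPT - A - B)"
  shows "f (OPT \<union> A) \<le> ((1 + \<beta>) * real p + 1) * f (set S)
    + (real p / \<beta> + real (p - 1)) * (f (set S) - f (set S0))
    + f (OPT \<inter> B) + real (card OPT) * \<alpha>"
proof -
  let ?R = "OPT - A - B"
  obtain r d where r: "0 \<le> r" "p = 0 \<longrightarrow> r = 0" "f A \<le> f (set S) + r"
    "\<beta> * r \<le> f (set S) - f (set S0)" and d: "\<And>l e. 0 \<le> d l e"
    "(\<Sum>l\<in>L. \<Sum>e\<in>G l. d l e) \<le> real (p - 1) * r" "\<forall>x\<in>?R. charged \<beta> d A S x"
    using acc unfolding accounts_def by blast
  have OX: "OPT \<subseteq> X" using OPT_feasible unfolding feasible_def by blast
  have fR: "finite ?R" using OX finite_X finite_subset by blast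
  have "\<exists>c. \<forall>x\<in>?R. (\<forall>l. 0 \<le> c x l) \<and>
     marginal f x A \<le> \<alpha> + (1 + \<beta>) * (\<Sum>l\<in>{l\<in>L. x \<in> G l}. c x l) \<and>
     (\<forall>l\<in>L. x \<in> G l \<longrightarrow> 0 < c x l \<longrightarrow> x \<in> matroid_span (I l) (level d S l (c x l)))"
    using d(3) unfolding charged_def by (rule bchoice)
  then obtain c where cR: "\<forall>x\<in>?R. (\<forall>l. 0 \<le> c x l) \<and>
     marginal f x A \<le> \<alpha> + (1 + \<beta>) * (\<Sum>l\<in>{l\<in>L. x \<in> G l}. c x l) \<and>
     (\<forall>l\<in>L. x \<in> G l \<longrightarrow> 0 < c x l \<longrightarrow> x \<in> matroid_span (I l) (level d S l (c x l)))" ..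
  have c: "marginal f x A \<le> \<alpha> + (1 + \<beta>) * (\<Sum>l\<in>{l\<in>L. x \<in> G l}. c x l)"
    "l \<in> L \<Longrightarrow> x \<in> G l \<Longrightarrow> 0 < c x l \<Longrightarrow> x \<in> matroid_span (I l) (level d S l (c x l))"
    if "x \<in> ?R" for x l
    using bspec[OF cR that] by auto
  have "(\<Sum>x\<in>?R. \<Sum>l\<in>{l\<in>L. x \<in> G l}. c x l) = (\<Sum>x\<in>?R. \<Sum>l\<in>L. if x \<in> G l then c x l else 0)"
    using finite_L by (simp add: sum.inter_filter)
  also have "\<dots> = (\<Sum>l\<in>L. \<Sum>x\<in>?R. if x \<in> G l then c x l else 0)" by (rule sum.swap)
  also have "\<dots> = (\<Sum>l\<in>L. \<Sum>x\<in>{x\<in>?R. x \<in> G l}. c x l)"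
    using fR by (intro sum.cong refl sum.inter_filter[symmetric])
  also have "\<dots> \<le> (\<Sum>l\<in>L. (\<Sum>e\<in>set S \<inter> G l. incr f e S) + (\<Sum>e\<in>G l. d l e))"
    using c(2) d(1) by (intro sum_mono level_charge_bound[OF S]) auto
  also have "\<dots> \<le> real p * f (set S) + real (p - 1) * r"
    using sum_incr_matroids[OF S] d(2) by (simp add: sum.distrib)
  finally have charge: "(\<Sum>x\<in>?R. \<Sum>l\<in>{l\<in>L. x \<in> G l}. c x l) \<le> real p * f (set S) + real (p - 1) * r" .

  have "f (A \<union> ?R) \<le> f A + (\<Sum>x\<in>?R. marginal f x A)"
    using fR OX AX by (intro union_le_sum_marginal[OF submodular]) auto
  also have "(\<Sum>x\<in>?R. marginal f x A) \<le> (\<Sum>x\<in>?R. \<alpha> + (1 + \<beta>) * (\<Sum>l\<in>{l\<in>L. x \<in> G l}. c x l))"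
    using c(1) by (rule sum_mono)
  also have "\<dots> = real (card ?R) * \<alpha> + (1 + \<beta>) * (\<Sum>x\<in>?R. \<Sum>l\<in>{l\<in>L. x \<in> G l}. c x l)"
    by (simp add: sum.distrib sum_distrib_left)
  also have "\<dots> \<le> real (card OPT) * \<alpha> + (1 + \<beta>) * (real p * f (set S) + real (p - 1) * r)"
  proof (intro add_mono mult_left_mono mult_right_mono charge)
    have "card ?R \<le> card OPT" using OX finite_X finite_subset by (intro card_mono) auto
    then show "real (card ?R) \<le> real (card OPT)" by simp
  qed (use alpha_nonneg beta in auto)
  finally have AR: "f (A \<union> ?R) \<le> f A + (real (card OPT) * \<alpha>
      + (1 + \<beta>) * (real p * f (set S) + real (p - 1) * r))" by simp

  \<comment> \<open>Submodularity together with non-negativity of the intersection term: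
    \<open>f\<close> is subadditive on these two sets.\<close>
  have "f ((A \<union> ?R) \<union> (OPT \<inter> B)) + f ((A \<union> ?R) \<inter> (OPT \<inter> B)) \<le> f (A \<union> ?R) + f (OPT \<inter> B)"
    using submodular[unfolded submodular_on_def, rule_format, of "A \<union> ?R" "OPT \<inter> B"] AX OX BX by auto
  moreover have "(A \<union> ?R) \<union> (OPT \<inter> B) = OPT \<union> A" by auto
  moreover have "0 \<le> f ((A \<union> ?R) \<inter> (OPT \<inter> B))"
    using nonneg[unfolded nonneg_on_def, rule_format, of "(A \<union> ?R) \<inter> (OPT \<inter> B)"] OX by blast
  ultimately have "f (OPT \<union> A) \<le> f (A \<union> ?R) + f (OPT \<inter> B)" by simp
  then have total: "f (OPT \<union> A) \<le> ((1 + \<beta>) * real p + 1) * f (set S)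
      + (r + (1 + \<beta>) * real (p - 1) * r) + f (OPT \<inter> B) + real (card OPT) * \<alpha>"
    using AR r(3) by (simp add: algebra_simps)
  \<comment> \<open>For positive \<open>p\<close> the left side is
    \<open>p * r + \<beta> * (p - 1) * r\<close>, that is, \<open>p / \<beta> + p - 1\<close> times
    \<open>\<beta> * r\<close>, and the gain of the pass is at least \<open>\<beta> * r\<close>. For
    \<open>p = 0\<close> the coefficient on the right is 0, and so is \<open>r\<close>.\<close>
  have "r + (1 + \<beta>) * real (p - 1) * r \<le> (real p / \<beta> + real (p - 1)) * (f (set S) - f (set S0))"
  proof (cases "p = 0")
    case True
    then show ?thesis using r(2) by simp
  next
    case False
    then have "real (p - 1) = real p - 1" by simp
    then have "r + (1 + \<beta>) * real (p - 1) * r = (real p / \<beta> + real (p - 1)) * (\<beta> * r)"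
      using beta by (simp add: field_simps)
    also have "\<dots> \<le> (real p / \<beta> + real (p - 1)) * (f (set S) - f (set S0))"
      using r(4) beta by (intro mult_left_mono) auto
    finally show ?thesis .
  qed
  then show ?thesis using total by linarith
qed

section \<open>The process with the set of all chosen elements\<close>

text \<open>The additional component \<open>A\<close> collects the initial solution of the pass and all elements
  that are ever drawn from the buffer.\<close>

definition traced_arrive :: "real \<Rightarrow> 'a \<Rightarrow> 'a set \<times> 'a list \<times> 'a set \<Rightarrow> ('a set \<times> 'a list \<times> 'a set) pmf"
  where "traced_arrive \<beta> x = (\<lambda>(A, S, B).
     if passes \<alpha> \<beta> S x then
       (if card (insert x B) = m then do {
          y \<leftarrow> pmf_of_set (insert x B);
          return_pmf (insert y A, insert_sol y S,
            {z \<in> insert x B - {y}. passes \<alpha> \<beta> (insert_sol y S) z}) }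
        else return_pmf (A, S, insert x B))
     else return_pmf (A, S, B))"

primrec traced_process ::
  "real \<Rightarrow> 'a list \<Rightarrow> 'a set \<times> 'a list \<times> 'a set \<Rightarrow> ('a set \<times> 'a list \<times> 'a set) pmf" where
  "traced_process \<beta> [] st = return_pmf st"
| "traced_process \<beta> (x # xs) st = bind_pmf (traced_arrive \<beta> x st) (traced_process \<beta> xs)"

lemma map_snd_traced_arrive: "map_pmf snd (traced_arrive \<beta> x st) = arrive \<alpha> \<beta> m x (snd st)"
  by (cases st) (simp add: traced_arrive_def arrive_def flush_def map_bind_pmf Let_def)

lemma map_snd_traced_process: "map_pmf snd (traced_process \<beta> xs st) = process \<alpha> \<beta> m xs (snd st)"
proof (induction xs arbitrary: st)
  case (Cons x xs)
  have "map_pmf snd (traced_process \<beta> (x # xs) st)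
      = bind_pmf (traced_arrive \<beta> x st) (\<lambda>s. process \<alpha> \<beta> m xs (snd s))"
    by (simp add: map_bind_pmf Cons.IH)
  also have "\<dots> = bind_pmf (map_pmf snd (traced_arrive \<beta> x st)) (process \<alpha> \<beta> m xs)"
    by (simp add: bind_map_pmf)
  finally show ?case by (simp add: map_snd_traced_arrive)
qed simp

text \<open>\<open>P\<close> is the set of elements that have arrived, so
  \<open>OPT \<inter> P - A - B\<close> consists of elements rejected on arrival or dropped from the
  buffer later.\<close>

definition pass_inv :: "real \<Rightarrow> 'a list \<Rightarrow> 'a set \<Rightarrow> 'a set \<times> 'a list \<times> 'a set \<Rightarrow> bool" where
  "pass_inv \<beta> S0 P = (\<lambda>(A, S, B). good S \<and> set S \<subseteq> A \<and> A \<subseteq> X \<and> B \<subseteq> X \<and>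
     (\<forall>y\<in>B. passes \<alpha> \<beta> S y) \<and> accounts \<beta> S0 A S (OPT \<inter> P - A - B))"

lemma pass_inv_initial: "good S0 \<Longrightarrow> pass_inv \<beta> S0 {} (set S0, S0, {})"
  unfolding pass_inv_def using accounts_initial good_subset by auto

text \<open>Good solutions are distinct lists over the finite \<open>X\<close>, so the reachable
  states are finitely many and all expectations are finite sums.\<close>

lemma pass_inv_finite:
  assumes "\<And>st. st \<in> set_pmf q \<Longrightarrow> pass_inv \<beta> S0 P st"
  shows "finite (set_pmf q)"
proof (rule finite_subset)
  show "set_pmf q \<subseteq> Pow X \<times> {S. good S} \<times> Pow X"
    using assms unfolding pass_inv_def by fastforce
  show "finite (Pow X \<times> {S. good S} \<times> Pow X)" using finite_good finite_X by blast
qed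

lemma pass_inv_arrive:
  assumes beta: "0 < \<beta>" and inv: "pass_inv \<beta> S0 P (A, S, B)" and x: "x \<in> X"
    and st: "st \<in> set_pmf (traced_arrive \<beta> x (A, S, B))"
  shows "pass_inv \<beta> S0 (insert x P) st"
proof -
  have S: "good S" "set S \<subseteq> A" "A \<subseteq> X" "B \<subseteq> X" and B: "\<And>y. y \<in> B \<Longrightarrow> passes \<alpha> \<beta> S y"
    and acc: "accounts \<beta> S0 A S (OPT \<inter> P - A - B)"
    using inv unfolding pass_inv_def by auto
  consider (reject) "\<not> passes \<alpha> \<beta> S x" "st = (A, S, B)"
    | (buffer) "passes \<alpha> \<beta> S x" "st = (A, S, insert x B)"
    | (flush) y where "passes \<alpha> \<beta> S x" "y \<in> insert x B"
        "st = (insert y A, insert_sol y S, {z \<in> insert x B - {y}. passes \<alpha> \<beta> (insert_sol y S) z})"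
  proof (cases "passes \<alpha> \<beta> S x \<and> card (insert x B) = m")
    case True
    have "finite (insert x B)" using S(4) finite_X finite_subset by blast
    then have "set_pmf (pmf_of_set (insert x B)) = insert x B" by (intro set_pmf_of_set) auto
    then show ?thesis using True st flush unfolding traced_arrive_def by auto
  next
    case False
    then show ?thesis using st reject buffer unfolding traced_arrive_def by (auto split: if_splits)
  qed
  then show ?thesis
  proof cases
    case reject
    have "accounts \<beta> S0 A S (OPT \<inter> insert x P - A - B)"
      by (rule accounts_reject[OF acc beta S(1-3)]) (use reject in auto)
    then show ?thesis unfolding reject(2) pass_inv_def using S B by simp
  next
    case buffer
    have "accounts \<beta> S0 A S (OPT \<inter> insert x P - A - insert x B)"
      by (rule accounts_reject[OF acc beta S(1-3)]) auto
    then show ?thesis unfolding buffer(2) pass_inv_def using S B buffer(1) x by simp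
  next
    case flush
    have y: "y \<in> X" "passes \<alpha> \<beta> S y" using flush S(4) x B by auto
    let ?T = "insert_sol y S"
    let ?B = "{z \<in> insert x B - {y}. passes \<alpha> \<beta> ?T z}"
    note facts = beta S(1) y
    have T: "good ?T" using good_insert_sol[OF facts] .
    have TA: "set ?T \<subseteq> insert y A" unfolding set_insert_sol[OF facts] using S(2) by blast
    have AX: "insert y A \<subseteq> X" using y(1) S(3) by blast
    have "OPT \<subseteq> X" using OPT_feasible unfolding feasible_def by blast
    then have RX: "OPT \<inter> P - A - B \<subseteq> X" by blast
    \<comment> \<open>First the swap of \<open>y\<close> is accounted for; then the elements that
      fail the test against the new solution are treated as rejections.\<close>
    have "accounts \<beta> S0 (insert y A) ?T (OPT \<inter> insert x P - insert y A - ?B)"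
      by (rule accounts_reject[OF accounts_insert_sol[OF acc facts S(2,3) RX] beta T TA AX]) auto
    then show ?thesis unfolding flush(3) pass_inv_def using T TA AX S(4) x by auto
  qed
qed

lemma pass_inv_process:
  assumes "0 < \<beta>" "pass_inv \<beta> S0 P st" "set xs \<subseteq> X" "st' \<in> set_pmf (traced_process \<beta> xs st)"
  shows "pass_inv \<beta> S0 (P \<union> set xs) st'"
  using assms
proof (induction xs arbitrary: P st)
  case (Cons x xs)
  then obtain s where s: "s \<in> set_pmf (traced_arrive \<beta> x st)" "st' \<in> set_pmf (traced_process \<beta> xs s)"
    by auto
  have "pass_inv \<beta> S0 (insert x P) s"
    using pass_inv_arrive[OF Cons.prems(1), of S0 P "fst st" "fst (snd st)" "snd (snd st)" x s]
      Cons.prems s(1) by simp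
  then have "pass_inv \<beta> S0 (insert x P \<union> set xs) st'"
    using Cons.prems s by (intro Cons.IH) auto
  then show ?case by simp
qed simp

lemma finite_traced_process:
  assumes "0 < \<beta>" "pass_inv \<beta> S0 P st" "set xs \<subseteq> X"
  shows "finite (set_pmf (traced_process \<beta> xs st))"
  using pass_inv_finite[OF pass_inv_process[OF assms]] .

section \<open>Sampling probabilities\<close>

text \<open>A flush draws a fixed element with probability at most \<open>1 / m\<close> and increases the value of
  the solution by at least \<open>\<alpha>\<close>, hence this quantity is a supermartingale.\<close>

definition potential :: "'a \<Rightarrow> 'a set \<times> 'a list \<times> 'a set \<Rightarrow> real" where
  "potential e = (\<lambda>(A, S, B). real m * \<alpha> * indicator A e - f (set S))"

lemma potential_arrive:
  assumes beta: "0 < \<beta>" and inv: "pass_inv \<beta> S0 P (A, S, B)" and x: "x \<in> X"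
  shows "measure_pmf.expectation (traced_arrive \<beta> x (A, S, B)) (potential e) \<le> potential e (A, S, B)"
proof (cases "passes \<alpha> \<beta> S x \<and> card (insert x B) = m")
  case False
  then show ?thesis unfolding traced_arrive_def by (auto simp: potential_def)
next
  case True
  have S: "good S" "B \<subseteq> X" and B: "\<And>y. y \<in> B \<Longrightarrow> passes \<alpha> \<beta> S y"
    using inv unfolding pass_inv_def by auto
  let ?B = "insert x B"
  let ?k = "\<lambda>y. (insert y A, insert_sol y S, {z \<in> ?B - {y}. passes \<alpha> \<beta> (insert_sol y S) z})"
  have fB: "finite ?B" using S(2) finite_X finite_subset by blast
  have m: "0 < m" "card ?B = m" using True fB card_gt_0_iff[of ?B] by auto
  have "traced_arrive \<beta> x (A, S, B) = map_pmf ?k (pmf_of_set ?B)"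
    using True unfolding traced_arrive_def by (simp add: map_pmf_def)
  then have "measure_pmf.expectation (traced_arrive \<beta> x (A, S, B)) (potential e)
      = measure_pmf.expectation (pmf_of_set ?B) (\<lambda>y. potential e (?k y))" by simp
  also have "\<dots> = (\<Sum>y\<in>?B. potential e (?k y)) / real m"
    using fB m(2) by (subst integral_pmf_of_set) auto
  \<comment> \<open>Each draw lowers the potential by at least \<alpha> through \<open>f\<close>,
    and only the draw of \<open>e\<close> can raise it, by at most \<open>m * \<alpha>\<close>. The
    latter happens for at most one of the \<open>m\<close> buffered elements, so on average the two
    effects cancel at worst.\<close>
  also have "\<dots> \<le> (\<Sum>y\<in>?B. potential e (A, S, B) - \<alpha> + (if y = e then real m * \<alpha> else 0)) / real m"
  proof (intro divide_right_mono sum_mono)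
    fix y assume "y \<in> ?B"
    then have y: "y \<in> X" "passes \<alpha> \<beta> S y" using x S(2) B True by auto
    have "0 \<le> \<beta> * (\<Sum>e\<in>exchange y S. incr f e S)"
      using exchange_sum_nonneg[OF beta S(1) y] beta by simp
    then have "f (set S) + \<alpha> \<le> f (set (insert_sol y S))"
      using value_insert_sol_gain[OF beta S(1) y] by linarith
    moreover have "0 \<le> real m * \<alpha>" using alpha_nonneg by simp
    ultimately show "potential e (?k y) \<le> potential e (A, S, B) - \<alpha> + (if y = e then real m * \<alpha> else 0)"
      unfolding potential_def by (auto simp: indicator_def)
  qed simp
  also have "(\<Sum>y\<in>?B. potential e (A, S, B) - \<alpha> + (if y = e then real m * \<alpha> else 0))
      = real m * (potential e (A, S, B) - \<alpha>) + (if e \<in> ?B then real m * \<alpha> else 0)"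
    unfolding sum.distrib using fB m(2) by (simp only: sum.delta sum_constant)
  also have "\<dots> / real m \<le> potential e (A, S, B)"
    using m(1) alpha_nonneg by (simp add: field_simps)
  finally show ?thesis .
qed

lemma potential_process:
  assumes "0 < \<beta>" "pass_inv \<beta> S0 P st" "set xs \<subseteq> X"
  shows "measure_pmf.expectation (traced_process \<beta> xs st) (potential e) \<le> potential e st"
  using assms
proof (induction xs arbitrary: P st)
  case (Cons x xs)
  obtain A S B where st: "st = (A, S, B)" by (cases st)
  have inv: "pass_inv \<beta> S0 (insert x P) s" if "s \<in> set_pmf (traced_arrive \<beta> x st)" for s
    using pass_inv_arrive[OF Cons.prems(1), of S0 P A S B x s] Cons.prems st that by simp
  have fin: "finite (set_pmf (traced_arrive \<beta> x st))" using pass_inv_finite[OF inv] .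
  have xs: "set xs \<subseteq> X" using Cons.prems by simp
  have "measure_pmf.expectation (traced_process \<beta> (x # xs) st) (potential e)
      = measure_pmf.expectation (traced_arrive \<beta> x st)
          (\<lambda>s. measure_pmf.expectation (traced_process \<beta> xs s) (potential e))"
    using finite_traced_process[OF Cons.prems(1) inv xs] fin
    by (subst traced_process.simps) (rule expectation_bind_finite)
  also have "\<dots> \<le> measure_pmf.expectation (traced_arrive \<beta> x st) (potential e)"
    using Cons.IH[OF Cons.prems(1) inv xs] by (intro expectation_mono_finite[OF fin])
  also have "\<dots> \<le> potential e st"
    using potential_arrive[OF Cons.prems(1), of S0 P A S B x e] Cons.prems st by simp
  finally show ?case .
qed simp

section \<open>The multi-pass algorithm\<close>

declare multipass.simps(2) [simp del]

context
  fixes stream :: "nat \<Rightarrow> 'a list" and \<beta> :: "nat \<Rightarrow> real" and d :: nat and g :: real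
  assumes off: "offline_approx X L G I f g offline"
    and streams: "\<forall>j\<in>{1..d}. set (stream j) = X"
    and betas: "\<forall>j\<in>{1..d}. 0 < \<beta> j"
begin

abbreviation "passes_dist j \<equiv> multipass stream \<alpha> \<beta> m j"
abbreviation "pass j S0 \<equiv> traced_process (\<beta> j) (stream j) (set S0, S0, {})"
abbreviation "sol_value \<equiv> \<lambda>(S, S'). f (set S)"
abbreviation "off_value \<equiv> \<lambda>(S, S'). f S'"

section \<open>The offline guarantee and the supports of the distributions\<close>

lemma stream: "j \<in> {1..d} \<Longrightarrow> set (stream j) = X" and beta: "j \<in> {1..d} \<Longrightarrow> 0 < \<beta> j"
  using streams betas by blast+

lemma offline_subset: "B \<subseteq> X \<Longrightarrow> S' \<in> set_pmf (offline B) \<Longrightarrow> S' \<subseteq> B"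
  using off unfolding offline_approx_def by blast

lemma finite_offline: "B \<subseteq> X \<Longrightarrow> finite (set_pmf (offline B))"
  by (rule finite_subset[of _ "Pow X"]) (use offline_subset finite_X in auto)

lemma offline_value:
  assumes "B \<subseteq> X" "T \<subseteq> B" "feasible X L G I T"
  shows "f T \<le> g * measure_pmf.expectation (offline B) f"
proof -
  have "finite {T. T \<subseteq> B \<and> feasible X L G I T}"
    by (rule finite_subset[of _ "Pow X"]) (use assms(1) finite_X in auto)
  then have "f T \<le> Max (f ` {T. T \<subseteq> B \<and> feasible X L G I T})"
    using assms by (intro Max_ge) auto
  also have "\<dots> \<le> g * measure_pmf.expectation (offline B) f"
    using off assms(1) unfolding offline_approx_def by simp
  finally show ?thesis .
qed

text \<open>On the whole of \<open>X\<close> the offline guarantee bounds the positive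
  \<open>f OPT\<close> by \<open>g\<close> times a non-negative expectation.\<close>

lemma offline_factor_nonneg: "0 < f OPT \<Longrightarrow> 0 \<le> g"
proof -
  assume "0 < f OPT"
  have OX: "OPT \<subseteq> X" using OPT_feasible unfolding feasible_def by blast
  have "0 < g * measure_pmf.expectation (offline X) f"
    using offline_value[OF order_refl OX OPT_feasible] \<open>0 < f OPT\<close> by linarith
  moreover have "measure_pmf.expectation (offline X) (\<lambda>_. 0) \<le> measure_pmf.expectation (offline X) f"
    using nonneg offline_subset unfolding nonneg_on_def
    by (intro expectation_mono_finite finite_offline) auto
  ultimately show "0 \<le> g" by (simp add: zero_less_mult_iff)
qed

lemma pass_inv_pass:
  assumes "j \<in> {1..d}" "good S0" "st \<in> set_pmf (pass j S0)"
  shows "pass_inv (\<beta> j) S0 X st"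
  using pass_inv_process[OF beta[OF assms(1)] pass_inv_initial[OF assms(2)] _ assms(3)] stream[OF assms(1)]
  by simp

lemma finite_pass: "j \<in> {1..d} \<Longrightarrow> good S0 \<Longrightarrow> finite (set_pmf (pass j S0))"
  using pass_inv_finite[OF pass_inv_pass] .

lemma multipass_Suc_traced:
  "passes_dist (Suc j) = bind_pmf (passes_dist j) (\<lambda>(S0, S0'). bind_pmf (pass (Suc j) S0)
     (\<lambda>(A, S, B). bind_pmf (offline B) (\<lambda>T'. return_pmf (S, if f S0' < f T' then T' else S0'))))"
proof -
  have "randomized_local_search (stream (Suc j)) S0 \<alpha> (\<beta> (Suc j)) m
      = bind_pmf (map_pmf snd (pass (Suc j) S0))
          (\<lambda>(S, B). bind_pmf (offline B) (\<lambda>S'. return_pmf (S, S')))" for S0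
    unfolding randomized_local_search_def map_snd_traced_process by simp
  then show ?thesis
    by (simp add: multipass.simps(2) bind_map_pmf bind_assoc_pmf bind_return_pmf case_prod_unfold
        cong: if_cong)
qed

lemma multipass_support:
  assumes "j \<le> d" "(S, S') \<in> set_pmf (passes_dist j)"
  shows "good S \<and> S' \<subseteq> X"
  using assms
proof (induction j arbitrary: S S')
  case 0
  then show ?case using good_Nil by simp
next
  case (Suc j)
  then obtain S0 S0' A B T' where st: "(S0, S0') \<in> set_pmf (passes_dist j)"
    "(A, S, B) \<in> set_pmf (pass (Suc j) S0)" "T' \<in> set_pmf (offline B)" "S' = T' \<or> S' = S0'"
    unfolding multipass_Suc_traced by (auto split: if_splits)
  have "good S0" "S0' \<subseteq> X" using Suc.IH[OF _ st(1)] Suc.prems by auto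
  moreover have "good S" "B \<subseteq> X"
    using pass_inv_pass[OF _ \<open>good S0\<close> st(2)] Suc.prems unfolding pass_inv_def by auto
  ultimately show ?case using offline_subset[OF \<open>B \<subseteq> X\<close> st(3)] st(4) by auto
qed

lemma finite_multipass: "j \<le> d \<Longrightarrow> finite (set_pmf (passes_dist j))"
proof (rule finite_subset)
  assume "j \<le> d"
  then show "set_pmf (passes_dist j) \<subseteq> {S. good S} \<times> Pow X" using multipass_support by auto
  show "finite ({S. good S} \<times> Pow X)" using finite_good finite_X by blast
qed

section \<open>Expectations after one more pass\<close>

lemma expectation_multipass_Suc:
  fixes h :: "'a list \<times> 'a set \<Rightarrow> real"
  assumes "Suc j \<le> d"
  shows "measure_pmf.expectation (passes_dist (Suc j)) h
    = measure_pmf.expectation (passes_dist j) (\<lambda>(S0, S0').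
        measure_pmf.expectation (pass (Suc j) S0) (\<lambda>(A, S, B).
          measure_pmf.expectation (offline B) (\<lambda>T'. h (S, if f S0' < f T' then T' else S0'))))"
proof -
  let ?K = "\<lambda>S0' B S. map_pmf (\<lambda>T'. (S, if f S0' < f T' then T' else S0')) (offline B)"
  have fB: "finite (set_pmf (?K S0' B S))" if "good S0" "(A, S, B) \<in> set_pmf (pass (Suc j) S0)" for S0 S0' A S B
    using pass_inv_pass[OF _ that] assms finite_offline unfolding pass_inv_def by simp
  have inner: "measure_pmf.expectation (bind_pmf (pass (Suc j) S0) (\<lambda>(A, S, B). ?K S0' B S)) h
      = measure_pmf.expectation (pass (Suc j) S0) (\<lambda>(A, S, B).
          measure_pmf.expectation (offline B) (\<lambda>T'. h (S, if f S0' < f T' then T' else S0')))"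
    and fin: "finite (set_pmf (bind_pmf (pass (Suc j) S0) (\<lambda>(A, S, B). ?K S0' B S)))"
    if S0: "good S0" for S0 S0'
  proof -
    have fp: "finite (set_pmf (pass (Suc j) S0))" using finite_pass S0 assms by simp
    have "measure_pmf.expectation (bind_pmf (pass (Suc j) S0) (\<lambda>(A, S, B). ?K S0' B S)) h
      = measure_pmf.expectation (pass (Suc j) S0)
          (\<lambda>st. measure_pmf.expectation ((\<lambda>(A, S, B). ?K S0' B S) st) h)"
      by (rule expectation_bind_finite[OF fp]) (use fB[OF S0] in auto)
    then show "measure_pmf.expectation (bind_pmf (pass (Suc j) S0) (\<lambda>(A, S, B). ?K S0' B S)) h
      = measure_pmf.expectation (pass (Suc j) S0) (\<lambda>(A, S, B).
          measure_pmf.expectation (offline B) (\<lambda>T'. h (S, if f S0' < f T' then T' else S0')))"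
      by (simp add: case_prod_unfold)
    show "finite (set_pmf (bind_pmf (pass (Suc j) S0) (\<lambda>(A, S, B). ?K S0' B S)))"
      unfolding set_bind_pmf using fp fB[OF S0] by auto
  qed
  have "passes_dist (Suc j) = bind_pmf (passes_dist j)
      (\<lambda>(S0, S0'). bind_pmf (pass (Suc j) S0) (\<lambda>(A, S, B). ?K S0' B S))"
    unfolding multipass_Suc_traced map_pmf_def ..
  then have "measure_pmf.expectation (passes_dist (Suc j)) h
      = measure_pmf.expectation (passes_dist j) (\<lambda>s. measure_pmf.expectation
          ((\<lambda>(S0, S0'). bind_pmf (pass (Suc j) S0) (\<lambda>(A, S, B). ?K S0' B S)) s) h)"
    using finite_multipass[of j] multipass_support[of j] fin assms
    by (simp only:) (rule expectation_bind_finite, auto)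
  also have "\<dots> = measure_pmf.expectation (passes_dist j) (\<lambda>(S0, S0').
        measure_pmf.expectation (pass (Suc j) S0) (\<lambda>(A, S, B).
          measure_pmf.expectation (offline B) (\<lambda>T'. h (S, if f S0' < f T' then T' else S0'))))"
    using multipass_support[of j] inner assms by (intro expectation_cong_finite) auto
  finally show ?thesis .
qed

lemma expectation_sol_value_Suc:
  assumes "Suc j \<le> d"
  shows "measure_pmf.expectation (passes_dist (Suc j)) sol_value
    = measure_pmf.expectation (passes_dist j) (\<lambda>(S0, S0').
        measure_pmf.expectation (pass (Suc j) S0) (\<lambda>(A, S, B). f (set S)))"
  unfolding expectation_multipass_Suc[OF assms] by simp

lemma off_value_mono:
  assumes "Suc j \<le> d"
  shows "measure_pmf.expectation (passes_dist j) off_value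
    \<le> measure_pmf.expectation (passes_dist (Suc j)) off_value"
  unfolding expectation_multipass_Suc[OF assms]
proof (rule expectation_mono_finite)
  show "finite (set_pmf (passes_dist j))" using assms by (intro finite_multipass) simp
  fix s assume s: "s \<in> set_pmf (passes_dist j)"
  obtain S0 S0' where s0: "s = (S0, S0')" by (cases s)
  have S0: "good S0" using multipass_support[of j S0 S0'] s s0 assms by auto
  have fp: "finite (set_pmf (pass (Suc j) S0))" using finite_pass S0 assms by simp
  have "f S0' = measure_pmf.expectation (pass (Suc j) S0) (\<lambda>_. f S0')" by simp
  also have "\<dots> \<le> measure_pmf.expectation (pass (Suc j) S0) (\<lambda>(A, S, B).
      measure_pmf.expectation (offline B) (\<lambda>T'. f (if f S0' < f T' then T' else S0')))"
  proof (rule expectation_mono_finite[OF fp], clarify)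
    fix A S B assume st: "(A, S, B) \<in> set_pmf (pass (Suc j) S0)"
    have "finite (set_pmf (offline B))"
      using pass_inv_pass[OF _ S0 st] assms finite_offline unfolding pass_inv_def by simp
    then have "measure_pmf.expectation (offline B) (\<lambda>_. f S0')
        \<le> measure_pmf.expectation (offline B) (\<lambda>T'. f (if f S0' < f T' then T' else S0'))"
      by (rule expectation_mono_finite) auto
    then show "f S0' \<le> measure_pmf.expectation (offline B) (\<lambda>T'. f (if f S0' < f T' then T' else S0'))"
      by simp
  qed
  finally show "off_value s \<le> (case s of (S0, S0') \<Rightarrow> measure_pmf.expectation (pass (Suc j) S0)
     (\<lambda>(A, S, B). measure_pmf.expectation (offline B)
       (\<lambda>T'. off_value (S, if f S0' < f T' then T' else S0'))))"
    unfolding s0 by simp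
qed

lemma off_value_ge_offline:
  assumes "Suc j \<le> d"
  shows "measure_pmf.expectation (passes_dist j) (\<lambda>(S0, S0').
      measure_pmf.expectation (pass (Suc j) S0) (\<lambda>(A, S, B). measure_pmf.expectation (offline B) f))
    \<le> measure_pmf.expectation (passes_dist (Suc j)) off_value"
  unfolding expectation_multipass_Suc[OF assms]
proof (rule expectation_mono_finite, goal_cases)
  case 1
  show ?case using assms by (intro finite_multipass) simp
next
  case (2 s)
  obtain S0 S0' where s0: "s = (S0, S0')" by (cases s)
  have S0: "good S0" using multipass_support[of j S0 S0'] 2 s0 assms by auto
  have fp: "finite (set_pmf (pass (Suc j) S0))" using finite_pass S0 assms by simp
  have "measure_pmf.expectation (pass (Suc j) S0) (\<lambda>(A, S, B). measure_pmf.expectation (offline B) f)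
    \<le> measure_pmf.expectation (pass (Suc j) S0) (\<lambda>(A, S, B).
      measure_pmf.expectation (offline B) (\<lambda>T'. f (if f S0' < f T' then T' else S0')))"
  proof (rule expectation_mono_finite[OF fp], clarify)
    fix A S B assume st: "(A, S, B) \<in> set_pmf (pass (Suc j) S0)"
    have "finite (set_pmf (offline B))"
      using pass_inv_pass[OF _ S0 st] assms finite_offline unfolding pass_inv_def by simp
    then show "measure_pmf.expectation (offline B) f
        \<le> measure_pmf.expectation (offline B) (\<lambda>T'. f (if f S0' < f T' then T' else S0'))"
      by (rule expectation_mono_finite) auto
  qed
  then show ?case unfolding s0 by simp
qed

section \<open>The probability that an element is ever drawn in a pass\<close>

definition trace_dist :: "nat \<Rightarrow> 'a set pmf" where
  "trace_dist j = bind_pmf (passes_dist j) (\<lambda>(S0, S0'). map_pmf fst (pass (Suc j) S0))"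

lemma expectation_trace_dist:
  fixes h :: "'a set \<Rightarrow> real"
  assumes "Suc j \<le> d"
  shows "measure_pmf.expectation (trace_dist j) h = measure_pmf.expectation (passes_dist j)
    (\<lambda>(S0, S0'). measure_pmf.expectation (pass (Suc j) S0) (\<lambda>(A, S, B). h A))"
proof -
  have "measure_pmf.expectation (trace_dist j) h = measure_pmf.expectation (passes_dist j)
      (\<lambda>s. measure_pmf.expectation ((\<lambda>(S0, S0'). map_pmf fst (pass (Suc j) S0)) s) h)"
    unfolding trace_dist_def
  proof (rule expectation_bind_finite)
    show "finite (set_pmf (passes_dist j))" using assms by (intro finite_multipass) simp
    fix s assume "s \<in> set_pmf (passes_dist j)"
    then have "good (fst s)" using multipass_support[of j "fst s" "snd s"] assms by simp
    then show "finite (set_pmf ((\<lambda>(S0, S0'). map_pmf fst (pass (Suc j) S0)) s))"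
      using finite_pass[of "Suc j" "fst s"] assms by (simp add: case_prod_unfold)
  qed
  then show ?thesis by (simp add: case_prod_unfold)
qed

lemma trace_dist_subset:
  assumes "Suc j \<le> d" "A \<in> set_pmf (trace_dist j)"
  shows "A \<subseteq> X"
proof -
  obtain S0 S0' S B where st: "(S0, S0') \<in> set_pmf (passes_dist j)" "(A, S, B) \<in> set_pmf (pass (Suc j) S0)"
    using assms(2) unfolding trace_dist_def by auto
  then show ?thesis
    using pass_inv_pass[OF _ _ st(2)] multipass_support[OF _ st(1)] assms(1) unfolding pass_inv_def by simp
qed

text \<open>The supermartingale bound, averaged over the starting solutions. Here
  \<open>trace_dist j\<close> belongs to pass \<open>Suc j\<close>, which starts from the outcome of
  \<open>passes_dist j\<close>.\<close>

lemma trace_potential: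
  assumes "Suc j \<le> d"
  shows "real m * \<alpha> * measure_pmf.expectation (trace_dist j) (\<lambda>A. indicator A e)
      - measure_pmf.expectation (passes_dist (Suc j)) sol_value
    \<le> real m * \<alpha> * measure_pmf.expectation (passes_dist j) (\<lambda>(S, S'). indicator (set S) e)
      - measure_pmf.expectation (passes_dist j) sol_value"
proof -
  have fj: "finite (set_pmf (passes_dist j))" using assms by (intro finite_multipass) simp
  have lin: "measure_pmf.expectation q (\<lambda>x. c * u x - v x)
      = c * measure_pmf.expectation q u - measure_pmf.expectation q v"
    if "finite (set_pmf q)" for c and q :: "'z pmf" and u v :: "'z \<Rightarrow> real"
    using that by (simp add: integrable_measure_pmf_finite)
  let ?a = "\<lambda>(S0, S0'). measure_pmf.expectation (pass (Suc j) S0) (\<lambda>(A, S, B). indicator A e :: real)"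
  let ?v = "\<lambda>(S0, S0'). measure_pmf.expectation (pass (Suc j) S0) (\<lambda>(A, S, B). f (set S))"
  have "real m * \<alpha> * measure_pmf.expectation (trace_dist j) (\<lambda>A. indicator A e)
      - measure_pmf.expectation (passes_dist (Suc j)) sol_value
    = measure_pmf.expectation (passes_dist j) (\<lambda>s. real m * \<alpha> * ?a s - ?v s)"
    unfolding expectation_trace_dist[OF assms] expectation_sol_value_Suc[OF assms] lin[OF fj] ..
  also have "\<dots> \<le> measure_pmf.expectation (passes_dist j)
      (\<lambda>s. real m * \<alpha> * (\<lambda>(S, S'). indicator (set S) e) s - sol_value s)"
  proof (rule expectation_mono_finite[OF fj])
    fix s assume s: "s \<in> set_pmf (passes_dist j)"
    obtain S0 S0' where s0: "s = (S0, S0')" by (cases s)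
    have S0: "good S0" using multipass_support[of j S0 S0'] s s0 assms by simp
    have fp: "finite (set_pmf (pass (Suc j) S0))" using finite_pass S0 assms by simp
    have "measure_pmf.expectation (pass (Suc j) S0) (potential e) \<le> potential e (set S0, S0, {})"
      using potential_process[OF beta pass_inv_initial[OF S0], of "Suc j"] stream[of "Suc j"] assms by simp
    moreover have "potential e = (\<lambda>st. real m * \<alpha> * (\<lambda>(A, S, B). indicator A e) st - (\<lambda>(A, S, B). f (set S)) st)"
      unfolding potential_def by auto
    ultimately show "real m * \<alpha> * ?a s - ?v s
        \<le> real m * \<alpha> * (\<lambda>(S, S'). indicator (set S) e) s - sol_value s"
      unfolding s0
      using lin[OF fp, of "real m * \<alpha>" "\<lambda>(A, S, B). indicator A e" "\<lambda>(A, S, B). f (set S)"] by simp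
  qed
  also have "\<dots> = real m * \<alpha> * measure_pmf.expectation (passes_dist j) (\<lambda>(S, S'). indicator (set S) e)
      - measure_pmf.expectation (passes_dist j) sol_value"
    unfolding lin[OF fj] ..
  finally show ?thesis .
qed

lemma sol_indicator_le_trace:
  assumes "Suc j \<le> d"
  shows "measure_pmf.expectation (passes_dist (Suc j)) (\<lambda>(S, S'). indicator (set S) e)
    \<le> measure_pmf.expectation (trace_dist j) (\<lambda>A. indicator A e :: real)"
  unfolding expectation_trace_dist[OF assms] expectation_multipass_Suc[OF assms]
proof (rule expectation_mono_finite, goal_cases)
  case 1
  show ?case using assms by (intro finite_multipass) simp
next
  case (2 s)
  obtain S0 S0' where s0: "s = (S0, S0')" by (cases s)
  have S0: "good S0" using multipass_support[of j S0 S0'] 2 s0 assms by auto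
  have fp: "finite (set_pmf (pass (Suc j) S0))" using finite_pass S0 assms by simp
  have "measure_pmf.expectation (pass (Suc j) S0) (\<lambda>(A, S, B). indicator (set S) e)
    \<le> measure_pmf.expectation (pass (Suc j) S0) (\<lambda>(A, S, B). indicator A e :: real)"
  proof (rule expectation_mono_finite[OF fp], clarify)
    fix A S B assume st: "(A, S, B) \<in> set_pmf (pass (Suc j) S0)"
    have "set S \<subseteq> A" using pass_inv_pass[OF _ S0 st] assms unfolding pass_inv_def by simp
    then show "indicator (set S) e \<le> (indicator A e :: real)" by (auto simp: indicator_def)
  qed
  then show ?case unfolding s0 by simp
qed

text \<open>The potential bound carries over from pass to pass: the final solution of a pass is
  contained in its \<open>A\<close>, so the next pass starts with a smaller indicator. Initially the
  solution is empty and \<open>f {}\<close> is non-negative.\<close>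

lemma sol_potential:
  "j \<le> d \<Longrightarrow> real m * \<alpha> * measure_pmf.expectation (passes_dist j) (\<lambda>(S, S'). indicator (set S) e)
    \<le> measure_pmf.expectation (passes_dist j) sol_value"
proof (induction j)
  case 0
  then show ?case using nonneg unfolding nonneg_on_def by simp
next
  case (Suc j)
  have "real m * \<alpha> * measure_pmf.expectation (passes_dist (Suc j)) (\<lambda>(S, S'). indicator (set S) e)
      \<le> real m * \<alpha> * measure_pmf.expectation (trace_dist j) (\<lambda>A. indicator A e)"
    using sol_indicator_le_trace[OF Suc.prems] alpha_nonneg by (intro mult_left_mono) auto
  then show ?case using trace_potential[OF Suc.prems, of e] Suc by linarith
qed

text \<open>By \<open>sol_potential\<close> the potential at the start of the pass has expectation
  at most 0, so the scaled probability is bounded by the expected value of the next solution, which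
  is feasible.\<close>

lemma trace_probability:
  assumes "Suc j \<le> d" "\<And>S. feasible X L G I S \<Longrightarrow> f S \<le> M"
  shows "real m * \<alpha> * measure_pmf.expectation (trace_dist j) (\<lambda>A. indicator A e) \<le> M"
proof -
  have "measure_pmf.expectation (passes_dist (Suc j)) sol_value
      \<le> measure_pmf.expectation (passes_dist (Suc j)) (\<lambda>_. M)"
    using finite_multipass[OF assms(1)] multipass_support[OF assms(1)] good_feasible assms(2)
    by (intro expectation_mono_finite) auto
  then show ?thesis using trace_potential[OF assms(1), of e] sol_potential[of j e] assms(1) by simp
qed

text \<open>The expectation of \<open>f (OPT \<union> A)\<close> is bounded from below by the
  sampling lemma, with probability bound \<open>f OPT / (real m * \<alpha>)\<close>, and from above
  by \<open>accounts_bound\<close> in every outcome.\<close>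

lemma pass_bound:
  assumes j: "Suc j \<le> d" and OPT: "\<And>S. feasible X L G I S \<Longrightarrow> f S \<le> f OPT" and m: "0 < real m * \<alpha>"
    and f_OPT: "0 < f OPT"
  shows "(1 - f OPT / (real m * \<alpha>)) * f OPT
    \<le> ((1 + \<beta> (Suc j)) * real p + 1) * measure_pmf.expectation (passes_dist (Suc j)) sol_value
      + (real p / \<beta> (Suc j) + real (p - 1)) * (measure_pmf.expectation (passes_dist (Suc j)) sol_value
          - measure_pmf.expectation (passes_dist j) sol_value)
      + g * measure_pmf.expectation (passes_dist (Suc j)) off_value + real (card OPT) * \<alpha>"
proof -
  let ?b = "\<beta> (Suc j)" and ?D = "passes_dist j"
  let ?c1 = "(1 + ?b) * real p + 1" and ?c2 = "real p / ?b + real (p - 1)"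
  let ?v = "\<lambda>(S0, S0'). measure_pmf.expectation (pass (Suc j) S0) (\<lambda>(A, S, B). f (set S))"
  let ?o = "\<lambda>(S0, S0'). measure_pmf.expectation (pass (Suc j) S0)
    (\<lambda>(A, S, B). measure_pmf.expectation (offline B) f)"
  have j': "Suc j \<in> {1..d}" "j \<le> d" using j by auto
  have fj: "finite (set_pmf ?D)" using j' by (intro finite_multipass)
  have lin: "measure_pmf.expectation ?D (\<lambda>s. a * u s + b * (u s - v s) + c * w s + k)
      = a * measure_pmf.expectation ?D u
        + b * (measure_pmf.expectation ?D u - measure_pmf.expectation ?D v)
        + c * measure_pmf.expectation ?D w + k" for a b c k :: real and u v w
    using fj by (simp add: integrable_measure_pmf_finite)
  have OX: "OPT \<subseteq> X" using OPT_feasible unfolding feasible_def by blast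
  have "(1 - f OPT / (real m * \<alpha>)) * f OPT \<le> measure_pmf.expectation (trace_dist j) (\<lambda>A. f (OPT \<union> A))"
  proof (rule expectation_sampled_union[OF submodular nonneg finite_X OX])
    show "0 \<le> f OPT / (real m * \<alpha>)" using m f_OPT by simp
    fix e
    show "measure_pmf.expectation (trace_dist j) (\<lambda>A. indicator A e) \<le> f OPT / (real m * \<alpha>)"
      using trace_probability[OF j OPT] m by (simp add: pos_le_divide_eq mult.commute)
  qed (use trace_dist_subset[OF j] in blast)
  also have "\<dots> \<le> measure_pmf.expectation ?D
      (\<lambda>s. ?c1 * ?v s + ?c2 * (?v s - sol_value s) + g * ?o s + real (card OPT) * \<alpha>)"
    unfolding expectation_trace_dist[OF j]
  proof (rule expectation_mono_finite[OF fj])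
    fix s assume s: "s \<in> set_pmf ?D"
    obtain S0 S0' where s0: "s = (S0, S0')" by (cases s)
    have S0: "good S0" using multipass_support[of j S0 S0'] s s0 j' by simp
    let ?Q = "pass (Suc j) S0"
    have fp: "finite (set_pmf ?Q)" using finite_pass S0 j' by simp
    have "measure_pmf.expectation ?Q (\<lambda>(A, S, B). f (OPT \<union> A))
      \<le> measure_pmf.expectation ?Q (\<lambda>st. ?c1 * (\<lambda>(A, S, B). f (set S)) st
          + ?c2 * ((\<lambda>(A, S, B). f (set S)) st - f (set S0))
          + g * (\<lambda>(A, S, B). measure_pmf.expectation (offline B) f) st + real (card OPT) * \<alpha>)"
    proof (rule expectation_mono_finite[OF fp])
      fix st assume st: "st \<in> set_pmf ?Q"
      obtain A S B where st0: "st = (A, S, B)" by (cases st)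
      have inv: "good S" "A \<subseteq> X" "B \<subseteq> X" "accounts ?b S0 A S (OPT - A - B)"
        using pass_inv_pass[OF j'(1) S0 st] OX unfolding pass_inv_def st0 by (auto simp: Int_absorb2)
      have "f (OPT \<inter> B) \<le> g * measure_pmf.expectation (offline B) f"
        using offline_value[OF inv(3), of "OPT \<inter> B"] feasible_subset[OF OPT_feasible] by simp
      then show "(\<lambda>(A, S, B). f (OPT \<union> A)) st \<le> ?c1 * (\<lambda>(A, S, B). f (set S)) st
          + ?c2 * ((\<lambda>(A, S, B). f (set S)) st - f (set S0))
          + g * (\<lambda>(A, S, B). measure_pmf.expectation (offline B) f) st + real (card OPT) * \<alpha>"
        unfolding st0 using accounts_bound[OF beta[OF j'(1)] inv] by simp
    qed
    also have "\<dots> = ?c1 * ?v (S0, S0') + ?c2 * (?v (S0, S0') - f (set S0)) + g * ?o (S0, S0')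
        + real (card OPT) * \<alpha>"
      using fp by (simp add: integrable_measure_pmf_finite)
    finally show "(\<lambda>(S0, S0'). measure_pmf.expectation (pass (Suc j) S0) (\<lambda>(A, S, B). f (OPT \<union> A))) s
      \<le> ?c1 * ?v s + ?c2 * (?v s - sol_value s) + g * ?o s + real (card OPT) * \<alpha>"
      unfolding s0 by (simp only: prod.case)
  qed
  also have "\<dots> = ?c1 * measure_pmf.expectation ?D ?v
      + ?c2 * (measure_pmf.expectation ?D ?v - measure_pmf.expectation ?D sol_value)
      + g * measure_pmf.expectation ?D ?o + real (card OPT) * \<alpha>"
    by (rule lin)
  \<comment> \<open>The best offline set so far is at least as good as the one of this pass;
    multiplying by \<open>g\<close> preserves this since \<open>g\<close> is non-negative.\<close>
  also have "\<dots> \<le> ?c1 * measure_pmf.expectation ?D ?v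
      + ?c2 * (measure_pmf.expectation ?D ?v - measure_pmf.expectation ?D sol_value)
      + g * measure_pmf.expectation (passes_dist (Suc j)) off_value + real (card OPT) * \<alpha>"
    using off_value_ge_offline[OF j] offline_factor_nonneg[OF f_OPT]
    by (intro add_mono mult_left_mono order_refl) auto
  finally show ?thesis unfolding expectation_sol_value_Suc[OF j] .
qed

end

end

section \<open>The two bounds for pass \<open>i\<close>, with the given \<alpha> and buffer
  size\<close>

theorem theorem5:
  fixes X OPT :: "'a set" and L :: "'l set"
    and G :: "'l \<Rightarrow> 'a set" and I :: "'l \<Rightarrow> 'a set set"
    and f :: "'a set \<Rightarrow> real"
    and sel :: "'a \<Rightarrow> 'a list \<Rightarrow> 'l \<Rightarrow> 'a"
    and offline :: "'a set \<Rightarrow> 'a set pmf"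
    and stream :: "nat \<Rightarrow> 'a list"
    and p k m d i :: nat
    and \<epsilon> \<alpha> \<gamma>_off \<gamma> \<delta> :: real
    and \<beta> :: "nat \<Rightarrow> real"
    and run :: "nat \<Rightarrow> ('a list \<times> 'a set) pmf"
    and ES ES' :: "nat \<Rightarrow> real"
  assumes "matchoid p X L G I"
    and "nonneg_on X f" and "submodular_on X f"
    and "k = matchoid_rank X L G I"
    and "is_arg_max f (feasible X L G I) OPT"
    and "offline_approx X L G I f \<gamma>_off offline"
    and "min_selection L G I f sel"
    and "\<And>j. j \<in> {1..d} \<Longrightarrow> distinct (stream j) \<and> set (stream j) = X"
    and "\<epsilon> > 0"
    and "\<alpha> = \<epsilon> * f OPT / (2 * real k)"
    and "m = nat \<lceil>4 * real d * real k / \<epsilon>\<^sup>2\<rceil>"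
    and "\<And>j. j \<in> {1..d} \<Longrightarrow> \<beta> j > 0"
    and "run = local_search.multipass L G I f sel offline stream \<alpha> \<beta> m"
    and "ES = (\<lambda>j. measure_pmf.expectation (run j) (\<lambda>(S, S'). f (set S)))"
    and "ES' = (\<lambda>j. measure_pmf.expectation (run j) (\<lambda>(S, S'). f S'))"
    and "1 < i" and "i \<le> d"
    and "(1 - \<epsilon>) * f OPT \<le> \<gamma> * ES (i - 1) + \<gamma>_off * ES' (i - 1)"
    and "ES i > 0"
    and "\<delta> = ES (i - 1) / ES i"
  shows "(1 - \<epsilon>) * f OPT \<le>
    min (\<gamma> * \<delta>)
        ((real p / \<beta> i + real p - 1) * (1 - \<delta>) + real p + \<beta> i * real p + 1) * ES i
    + \<gamma>_off * ES' i"
proof -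
  let ?mp = "local_search.multipass L G I f sel offline stream \<alpha> \<beta> m"
  interpret B: matchoid_local_search L G I f sel offline X p
    using assms(1,7) by unfold_locales
  have finX: "finite X" using B.finite_X .
  have nonneg: "0 \<le> f A" if "A \<subseteq> X" for A using assms(2) that unfolding nonneg_on_def by blast
  have OPT: "feasible X L G I OPT" and OPT_max: "\<And>S. feasible X L G I S \<Longrightarrow> f S \<le> f OPT"
    using assms(5) unfolding is_arg_max_def by (auto simp: not_less)
  have OPT_sub: "OPT \<subseteq> X" using OPT unfolding feasible_def by blast
  have rank: "card S \<le> k" if "feasible X L G I S" for S
  proof -
    have "finite {S. feasible X L G I S}"
      by (rule finite_subset[of _ "Pow X"]) (use finX in \<open>auto simp: feasible_def\<close>)
    then show ?thesis unfolding assms(4) matchoid_rank_def using that by (intro Max_ge) auto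
  qed
  have streams: "\<forall>j\<in>{1..d}. set (stream j) = X" and betas: "\<forall>j\<in>{1..d}. 0 < \<beta> j"
    using assms(8,12) by blast+
  have ES: "ES j = measure_pmf.expectation (?mp j) (\<lambda>(S, S'). f (set S))"
    and ES': "ES' j = measure_pmf.expectation (?mp j) (\<lambda>(S, S'). f S')" for j
    using assms(13-15) by auto
  \<comment> \<open>All solutions are feasible, so a non-positive optimum would contradict the
    positive expectation in pass \<open>i\<close>.\<close>
  have "0 < f OPT"
  proof (rule ccontr)
    assume "\<not> ?thesis"
    then have "f S \<le> 0" if "feasible X L G I S" for S using OPT_max[OF that] by simp
    then have "(case s of (S, S') \<Rightarrow> f (set S)) \<le> 0" if "s \<in> set_pmf (?mp i)" for s
      using B.multipass_feasible[OF streams assms(17), of "fst s" "snd s"] that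
      by (simp add: case_prod_unfold)
    then have "0 \<le> measure_pmf.expectation (?mp i) (\<lambda>s. - (case s of (S, S') \<Rightarrow> f (set S)))"
      by (intro integral_nonneg_AE) (auto simp: AE_measure_pmf_iff)
    then show False using assms(19) ES[of i] by simp
  qed
  have k_pos: "0 < k" if "feasible X L G I S" "S \<noteq> {}" for S
  proof -
    have "finite S" using that(1) finX finite_subset unfolding feasible_def by blast
    then have "0 < card S" using that(2) by (simp add: card_gt_0_iff)
    then show ?thesis using rank[OF that(1)] by simp
  qed
  interpret S: matchoid_search L G I f sel offline X p OPT m \<alpha>
  proof
    show "0 \<le> \<alpha>" using assms(9,10) \<open>0 < f OPT\<close> by simp
    show "0 < \<alpha>" if "feasible X L G I S" "S \<noteq> {}" for S
      using k_pos[OF that] assms(9,10) \<open>0 < f OPT\<close> by simp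
  qed (use assms(2,3) OPT in auto)
  note ctx = assms(6) streams betas
  have g: "0 \<le> \<gamma>_off" using S.offline_factor_nonneg[OF ctx \<open>0 < f OPT\<close>] .
  have ES'_mono: "ES' j \<le> ES' (Suc j)" if "Suc j \<le> d" for j
    unfolding ES' using S.off_value_mono[OF ctx that] .
  obtain i' where i': "i = Suc i'" "1 \<le> i'" "Suc i' \<le> d" using assms(16,17) by (cases i) auto
  have prev: "\<gamma>_off * ES' i' \<le> \<gamma>_off * ES' i" using ES'_mono[OF i'(3)] g i'(1) by (simp add: mult_left_mono)
  have delta: "\<delta> * ES i = ES i'" using assms(19,20) i'(1) by simp
  \<comment> \<open>The hypothesis on the previous pass survives, because the best offline set only
    improves.\<close>
  have first: "(1 - \<epsilon>) * f OPT \<le> \<gamma> * \<delta> * ES i + \<gamma>_off * ES' i"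
    using assms(18) delta prev i'(1) by (simp add: mult.assoc)
  have bound: "(1 - \<epsilon>) * f OPT \<le> ((1 + \<beta> (Suc j)) * real p + 1) * ES (Suc j)
      + (real p / \<beta> (Suc j) + real (p - 1)) * (ES (Suc j) - ES j) + \<gamma>_off * ES' (Suc j)"
    if j: "Suc j \<le> d" for j
  proof (cases "k = 0")
    \<comment> \<open>Only the empty set is feasible, so every solution has value
      \<open>f {}\<close>, which is also the optimum. Division by zero makes \<alpha> equal to 0,
      and \<open>pass_bound\<close> does not apply.\<close>
    case True
    have "f OPT = f {}" using k_pos[OF OPT] True by auto
    have ES_empty: "ES j = f {}" if "j \<le> d" for j
    proof -
      have "ES j = measure_pmf.expectation (?mp j) (\<lambda>_. f {})"
        unfolding ES
      proof (rule expectation_cong_finite)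
        fix s assume "s \<in> set_pmf (?mp j)"
        then have "set (fst s) = {}"
          using B.multipass_feasible[OF streams that, of "fst s" "snd s"] k_pos True by fastforce
        then show "(case s of (S, S') \<Rightarrow> f (set S)) = f {}" by (simp add: case_prod_unfold)
      qed
      then show ?thesis by simp
    qed
    have "0 \<le> ES' (Suc j)"
      unfolding ES' using S.multipass_support[OF ctx j] nonneg
      by (intro integral_nonneg_AE) (auto simp: AE_measure_pmf_iff)
    then have "0 \<le> \<gamma>_off * ES' (Suc j)" using g by simp
    moreover have "0 \<le> (1 + \<beta> (Suc j)) * real p * f {}"
      using assms(12)[of "Suc j"] j nonneg[of "{}"] by simp
    moreover have "0 \<le> \<epsilon> * f {}" using assms(9) nonneg[of "{}"] by simp
    ultimately show ?thesis
      using ES_empty[of j] ES_empty[OF j] j \<open>f OPT = f {}\<close> by (simp add: algebra_simps)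
  next
    case False
    then have k: "0 < real k" and d: "1 \<le> real d" using j by auto
    have m: "4 * real d * real k / \<epsilon>\<^sup>2 \<le> real m" unfolding assms(11) by (rule real_nat_ceiling_ge)
    have \<alpha>: "0 < \<alpha>" using assms(9,10) \<open>0 < f OPT\<close> k by simp
    \<comment> \<open>The choice of \<open>m\<close> makes \<open>m * \<alpha>\<close> at least
      \<open>2 * f OPT / \<epsilon>\<close>, so an element is drawn with probability at most
      \<open>\<epsilon> / 2\<close>. The other half of \<epsilon> goes to the additive terms, since
      \<open>k * \<alpha>\<close> equals \<open>\<epsilon> / 2 * f OPT\<close>.\<close>
    have "2 * f OPT / \<epsilon> \<le> 2 * real d * f OPT / \<epsilon>"
      using d \<open>0 < f OPT\<close> assms(9) by (simp add: divide_right_mono)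
    also have "\<dots> = (4 * real d * real k / \<epsilon>\<^sup>2) * \<alpha>"
      unfolding assms(10) using assms(9) k by (simp add: field_simps power2_eq_square)
    also have "\<dots> \<le> real m * \<alpha>" using m \<alpha> by (intro mult_right_mono) auto
    finally have m\<alpha>: "2 * f OPT / \<epsilon> \<le> real m * \<alpha>" .
    moreover have "0 < 2 * f OPT / \<epsilon>" using \<open>0 < f OPT\<close> assms(9) by simp
    ultimately have pos: "0 < real m * \<alpha>" by linarith
    have "f OPT / (real m * \<alpha>) \<le> \<epsilon> / 2"
      using m\<alpha> pos assms(9) by (simp add: field_simps)
    then have "f OPT / (real m * \<alpha>) * f OPT \<le> \<epsilon> / 2 * f OPT"
      using \<open>0 < f OPT\<close> by (intro mult_right_mono) auto
    moreover have "real (card OPT) * \<alpha> \<le> real k * \<alpha>"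
      using rank[OF OPT] \<alpha> by (intro mult_right_mono) auto
    moreover have "real k * \<alpha> = \<epsilon> / 2 * f OPT" unfolding assms(10) using k by simp
    ultimately have "(1 - \<epsilon>) * f OPT \<le> (1 - f OPT / (real m * \<alpha>)) * f OPT - real (card OPT) * \<alpha>"
      unfolding left_diff_distrib mult_1_left by linarith
    then show ?thesis
      using S.pass_bound[OF ctx j OPT_max pos \<open>0 < f OPT\<close>] unfolding ES ES' by linarith
  qed
  have second: "(1 - \<epsilon>) * f OPT
    \<le> ((real p / \<beta> i + real p - 1) * (1 - \<delta>) + real p + \<beta> i * real p + 1) * ES i + \<gamma>_off * ES' i"
  proof (cases "p = 0")
    case True
    \<comment> \<open>Here the claimed factor is \<open>\<delta>\<close>, so the bound is needed for the previous pass.\<close>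
    obtain j where j: "i' = Suc j" using i'(2) by (cases i') auto
    have "(1 - \<epsilon>) * f OPT \<le> ES i' + \<gamma>_off * ES' i'" using bound[of j] j True i'(3) by simp
    then show ?thesis using True delta prev by simp
  next
    case False
    let ?c = "real p / \<beta> i + real (p - 1)"
    have "real p / \<beta> i + real p - 1 = ?c" using False by simp
    \<comment> \<open>With \<open>v = ES i\<close> the product \<open>\<delta> * v\<close> is the
      expected value after the previous pass, so the difference of the two solution values becomes
      \<open>(1 - \<delta>) * v\<close>.\<close>
    moreover have "(c * (1 - \<delta>) + a + b * a + 1) * v = ((1 + b) * a + 1) * v + c * (v - \<delta> * v)"
      for a b c v :: real by algebra
    ultimately show ?thesis using bound[OF i'(3), folded i'(1)] by (simp only: delta)
  qed
  show ?thesis using first second by (simp add: min_def)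
qed

end
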